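(* Let $G$ be a group with finite generating set $S$ such that the Cayley graph $\Gamma=\Gamma(G,S)$ has finitely many extended cone types $t_0,t_1,\dots,t_q$, indexed so that $\bar C(1)\in t_0$. Then the spherical growth series $\Delta(z)$ is rational, and its presentation as a ratio $P(z)/Q(z)$ of two polynomials can be computed from the data $((t_j)_j,(m_j)_j,(n_{i,j})_{i,j})$. In fact $\Delta(z)=\sum_{j=0}^q f_j(z)$, where $(f_j(z))_{j=0}^q$ are obtained by solving the linear system of equations $$f_0(z)=1,\qquad f_j(z)=\frac{z}{m_j}\sum_{i=0}^q n_{i,j}f_i(z)\quad\text{for all } j\neq 0.$$
   Context: $|g|$ denotes the word length of $g\in G$ with respect to $S$, and $\Delta(z)=\sum_{n\ge0}|\{g\in G:|g|=n\}|z^n$. $\Gamma$ is the undirected left Cayley graph: vertex set $G$, and an edge joining $g$ and $sg$ for each $g\in G$, $s\in S$ (if $s$ has order 2, the pair of edges $(g,sg),(sg,g)$ is replaced by a single edge). An edge $(g,h)$ of $\Gamma$ is tangent if $|g|=|h|$; otherwise $||g|-|h||=1$ and it is called normal. For $g\in G$, $A^t_g$ is the set of tangent edges at $g$, $A^+_g$ the set of edges $(g,h)$ with $|h|=|g|+1$, and $A^-_g$ the set of edges $(g,h)$ with $|h|=|g|-1$. For $g\in G$ the cone $C(g)$ is the subgraph of $\Gamma$ induced on the set of $h\in G$ such that some geodesic path in $\Gamma$ from $1$ to $h$ passes through $g$. The extended cone $\bar C(g)$ is the subgraph of $\Gamma$ obtained from $C(g)$ by adding all tangent edges $(h,k)$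 of $\Gamma$ with $h\in C(g)$, together with their endpoints $k$. Two extended cones $\bar C(g),\bar C(h)$ are strongly equivalent, $\bar C(g)\sim\bar C(h)$, if there is a graph isomorphism $T:\bar C(g)\to\bar C(h)$ with $T(g)=h$ and $T(C(g))=C(h)$; the equivalence classes are the extended cone types. Set $m(\bar C(g))=|A^-_g|$ and $n(\bar C(g),\bar C(h))=|\{(g,h')\in A^+_g:\bar C(h')\sim\bar C(h)\}|$. These numbers depend only on the extended cone types involved; $m_j$ denotes the value of $m$ on the type $t_j$ and $n_{i,j}$ the value of $n$ on the pair $(t_i,t_j)$. *)

theory Defs
  imports
    "HOL-Algebra.Generated_Groups"
    "HOL-Computational_Algebra.Polynomial_FPS"
    "HOL-Computational_Algebra.Polynomial_Factorial"
    "Jordan_Normal_Form.Determinant"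
begin

section \<open>Undirected multigraphs\<close>

text \<open>Every edge \<open>e\<close> has a set \<open>ends e\<close> of one endpoint (a loop) or two endpoints.\<close>

record ('v, 'e) multigraph =
  verts :: "'v set"
  edges :: "'e set"
  ends  :: "'e \<Rightarrow> 'v set"

definition walk :: "('v, 'e) multigraph \<Rightarrow> 'v list \<Rightarrow> bool" where
  "walk \<Gamma> p \<longleftrightarrow> p \<noteq> [] \<and> set p \<subseteq> verts \<Gamma> \<and>
     (\<forall>i. Suc i < length p \<longrightarrow> (\<exists>e\<in>edges \<Gamma>. ends \<Gamma> e = {p ! i, p ! Suc i}))"

definition geodesic :: "('v, 'e) multigraph \<Rightarrow> 'v \<Rightarrow> 'v \<Rightarrow> 'v list \<Rightarrow> bool" where
  "geodesic \<Gamma> u v p \<longleftrightarrow> walk \<Gamma> p \<and> hd p = u \<and> last p = v \<and>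
     (\<forall>p'. walk \<Gamma> p' \<and> hd p' = u \<and> last p' = v \<longrightarrow> length p \<le> length p')"

definition induced_subgraph :: "('v, 'e) multigraph \<Rightarrow> 'v set \<Rightarrow> ('v, 'e) multigraph" where
  "induced_subgraph \<Gamma> V =
     \<lparr>verts = verts \<Gamma> \<inter> V, edges = {e \<in> edges \<Gamma>. ends \<Gamma> e \<subseteq> V}, ends = ends \<Gamma>\<rparr>"

definition graph_iso ::
    "('v, 'e) multigraph \<Rightarrow> ('w, 'f) multigraph \<Rightarrow> ('v \<Rightarrow> 'w) \<Rightarrow> ('e \<Rightarrow> 'f) \<Rightarrow> bool" where
  "graph_iso \<Gamma> \<Gamma>' \<phi> \<psi> \<longleftrightarrow>
     bij_betw \<phi> (verts \<Gamma>) (verts \<Gamma>') \<and> bij_betw \<psi> (edges \<Gamma>) (edges \<Gamma>') \<and>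
     (\<forall>e\<in>edges \<Gamma>. ends \<Gamma>' (\<psi> e) = \<phi> ` ends \<Gamma> e)"


section \<open>Word length, spherical growth and the Cayley graph\<close>

definition word_length :: "('a, 'b) monoid_scheme \<Rightarrow> 'a set \<Rightarrow> 'a \<Rightarrow> nat" where
  "word_length G S g =
     (LEAST n. \<exists>w. set w \<subseteq> S \<union> (m_inv G ` S) \<and> length w = n \<and> foldr (\<lambda>x y. x \<otimes>\<^bsub>G\<^esub> y) w \<one>\<^bsub>G\<^esub> = g)"

definition spherical_growth :: "('a, 'b) monoid_scheme \<Rightarrow> 'a set \<Rightarrow> rat fps" where
  "spherical_growth G S = Abs_fps (\<lambda>n. of_nat (card {g \<in> carrier G. word_length G S g = n}))"

text \<open>
  The edge joining \<open>g\<close> and \<open>s \<otimes> g\<close> that comes from the pair \<open>(g, s)\<close> is encoded as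
  \<open>({g, s \<otimes> g}, s)\<close>.  Two distinct pairs have the same code exactly when they are \<open>(g, s)\<close> and
  \<open>(s \<otimes> g, s)\<close> with \<open>s\<close> of order 2, so this is precisely the identification of the two opposite
  edges of an involution.  The set \<open>S\<close> need not be symmetric; if it contains \<open>s\<close> and its inverse,
  with \<open>s\<close> not of order 1 or 2, then \<open>g\<close> and \<open>s \<otimes> g\<close> are joined by two edges.
\<close>

definition cayley_graph :: "('a, 'b) monoid_scheme \<Rightarrow> 'a set \<Rightarrow> ('a, 'a set \<times> 'a) multigraph" where
  "cayley_graph G S =
     \<lparr>verts = carrier G,
      edges = {({g, s \<otimes>\<^bsub>G\<^esub> g}, s) | g s. g \<in> carrier G \<and> s \<in> S},
      ends = fst\<rparr>"

definition tangent_edges_at :: "('a, 'b) monoid_scheme \<Rightarrow> 'a set \<Rightarrow> 'a \<Rightarrow> ('a set \<times> 'a) set" where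
  "tangent_edges_at G S g = {e \<in> edges (cayley_graph G S). \<exists>h.
     ends (cayley_graph G S) e = {g, h} \<and> word_length G S h = word_length G S g}"

definition up_edges_at :: "('a, 'b) monoid_scheme \<Rightarrow> 'a set \<Rightarrow> 'a \<Rightarrow> ('a set \<times> 'a) set" where
  "up_edges_at G S g = {e \<in> edges (cayley_graph G S). \<exists>h.
     ends (cayley_graph G S) e = {g, h} \<and> word_length G S h = word_length G S g + 1}"

definition down_edges_at :: "('a, 'b) monoid_scheme \<Rightarrow> 'a set \<Rightarrow> 'a \<Rightarrow> ('a set \<times> 'a) set" where
  "down_edges_at G S g = {e \<in> edges (cayley_graph G S). \<exists>h.
     ends (cayley_graph G S) e = {g, h} \<and> word_length G S h + 1 = word_length G S g}"


section \<open>Extended cone types\<close>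

definition cone :: "('a, 'b) monoid_scheme \<Rightarrow> 'a set \<Rightarrow> 'a \<Rightarrow> ('a, 'a set \<times> 'a) multigraph" where
  "cone G S g = induced_subgraph (cayley_graph G S)
     {h \<in> carrier G. \<exists>p. geodesic (cayley_graph G S) \<one>\<^bsub>G\<^esub> h p \<and> g \<in> set p}"

definition extended_cone ::
    "('a, 'b) monoid_scheme \<Rightarrow> 'a set \<Rightarrow> 'a \<Rightarrow> ('a, 'a set \<times> 'a) multigraph" where
  "extended_cone G S g =
     (let T = (\<Union>h\<in>verts (cone G S g). tangent_edges_at G S h) in
      \<lparr>verts = verts (cone G S g) \<union> (\<Union>e\<in>T. ends (cayley_graph G S) e),
       edges = edges (cone G S g) \<union> T,
       ends = ends (cayley_graph G S)\<rparr>)"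

text \<open>
  Strong equivalence of the extended cones of \<open>g\<close> and \<open>h\<close>.  Since it involves the base point and
  the cone, it is a relation on the group elements: different elements may have the same
  extended cone as a bare graph.  Extended cone types are thus rendered as classes of elements.
\<close>

definition strongly_equivalent :: "('a, 'b) monoid_scheme \<Rightarrow> 'a set \<Rightarrow> 'a \<Rightarrow> 'a \<Rightarrow> bool" where
  "strongly_equivalent G S g h \<longleftrightarrow> (\<exists>\<phi> \<psi>.
     graph_iso (extended_cone G S g) (extended_cone G S h) \<phi> \<psi> \<and> \<phi> g = h \<and>
     \<phi> ` verts (cone G S g) = verts (cone G S h) \<and>
     \<psi> ` edges (cone G S g) = edges (cone G S h))"

definition extended_cone_types :: "('a, 'b) monoid_scheme \<Rightarrow> 'a set \<Rightarrow> 'a set set" where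
  "extended_cone_types G S =
     carrier G // {(g, h). g \<in> carrier G \<and> h \<in> carrier G \<and> strongly_equivalent G S g h}"

definition cone_m :: "('a, 'b) monoid_scheme \<Rightarrow> 'a set \<Rightarrow> 'a \<Rightarrow> nat" where
  "cone_m G S g = card (down_edges_at G S g)"

definition cone_n :: "('a, 'b) monoid_scheme \<Rightarrow> 'a set \<Rightarrow> 'a \<Rightarrow> 'a \<Rightarrow> nat" where
  "cone_n G S g h = card {e \<in> up_edges_at G S g.
     \<exists>h'. ends (cayley_graph G S) e = {g, h'} \<and> strongly_equivalent G S h' h}"

definition type_m :: "('a, 'b) monoid_scheme \<Rightarrow> 'a set \<Rightarrow> 'a set \<Rightarrow> nat" where
  "type_m G S T = (THE k. \<forall>g\<in>T. cone_m G S g = k)"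

definition type_n :: "('a, 'b) monoid_scheme \<Rightarrow> 'a set \<Rightarrow> 'a set \<Rightarrow> 'a set \<Rightarrow> nat" where
  "type_n G S T U = (THE k. \<forall>g\<in>T. \<forall>h\<in>U. cone_n G S g h = k)"


section \<open>The linear system\<close>

definition growth_system ::
    "'r::{comm_semiring_1, inverse} \<Rightarrow> nat \<Rightarrow> (nat \<Rightarrow> nat) \<Rightarrow> (nat \<Rightarrow> nat \<Rightarrow> nat) \<Rightarrow> (nat \<Rightarrow> 'r) \<Rightarrow> bool"
  where
  "growth_system z q m n f \<longleftrightarrow> f 0 = 1 \<and>
     (\<forall>j\<in>{1..q}. f j = z / of_nat (m j) * (\<Sum>i\<le>q. of_nat (n i j) * f i))"

text \<open>The indeterminate of the field of rational functions over the rationals.\<close>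

definition ratfun_z :: "rat poly fract" where
  "ratfun_z = to_fract [:0, 1:]"

text \<open>The power series \<open>F\<close> is the expansion at \<open>0\<close> of the rational function \<open>r\<close>.\<close>

definition expands_to :: "rat poly fract \<Rightarrow> rat fps \<Rightarrow> bool" where
  "expands_to r F \<longleftrightarrow>
     (\<exists>P Q. Q \<noteq> 0 \<and> r = to_fract P / to_fract Q \<and> F * fps_of_poly Q = fps_of_poly P)"

text \<open>
  An explicit presentation \<open>P / Q\<close> of the sum of the solutions, computed from \<open>q\<close>, \<open>m\<close> and \<open>n\<close>
  alone.  It is Cramer's rule for the system after row \<open>j \<noteq> 0\<close> has been multiplied by \<open>m j\<close>, i.e.
  \<open>m j * f j - z * (\<Sum>i\<le>q. n i j * f i) = 0\<close>.
\<close>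

definition system_matrix :: "nat \<Rightarrow> (nat \<Rightarrow> nat) \<Rightarrow> (nat \<Rightarrow> nat \<Rightarrow> nat) \<Rightarrow> rat poly mat" where
  "system_matrix q m n = mat (Suc q) (Suc q) (\<lambda>(j, i).
     if j = 0 then (if i = 0 then 1 else 0)
     else (if i = j then of_nat (m j) else 0) - [:0, 1:] * of_nat (n i j))"

definition growth_denominator :: "nat \<Rightarrow> (nat \<Rightarrow> nat) \<Rightarrow> (nat \<Rightarrow> nat \<Rightarrow> nat) \<Rightarrow> rat poly" where
  "growth_denominator q m n = det (system_matrix q m n)"

definition growth_numerator :: "nat \<Rightarrow> (nat \<Rightarrow> nat) \<Rightarrow> (nat \<Rightarrow> nat \<Rightarrow> nat) \<Rightarrow> rat poly" where
  "growth_numerator q m n =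
     (\<Sum>j\<le>q. det (replace_col (system_matrix q m n) (unit_vec (Suc q) 0) j))"

end

theory Submission
  imports Defs
begin

text \<open>
  Double counting the edges between the spheres of radius \<open>k\<close> and \<open>k + 1\<close> that end in a given
  type yields the linear system, once \<open>m\<close> and \<open>n\<close> are known to be constant on types.
  An isomorphism of extended cones that respects the cones preserves the word length up to an
  additive constant, since it maps each step away from the base point to an edge and so does its
  inverse.  It hence respects the cones and the tangent edges of all elements of the cone and
  restricts to strong equivalences there, which handles \<open>n\<close>.  The edges at \<open>g\<close> that are missing in
  the extended cone of \<open>g\<close> are the downward ones and all vertices have the same degree, which
  handles \<open>m\<close>.  As \<open>m\<close> vanishes only at the identity, the identity is the only element of its type.
  At \<open>z = 0\<close> the matrix of the system is diagonal with nonzero entries, so its determinant is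
  invertible as a power series and as a rational function, and Cramer's rule applies in both rings.
\<close>

section \<open>Cramer's rule for the linear system\<close>

text \<open>Row \<open>j\<close> of the matrix is equation \<open>j\<close> multiplied by
  \<open>m j\<close>, which is reversible when \<open>m j\<close> is a unit. The ring is left open
  because the system is solved both in power series and in rational functions. Division in
  \<open>'r\<close> is subject to no axiom, so the needed cancellation is a hypothesis.\<close>

lemma growth_system_iff_mult_vec:
  fixes hom :: "rat poly \<Rightarrow> 'r :: {comm_ring_1, inverse}"
  assumes "comm_ring_hom hom"
    and z: "hom [:0, 1:] = z"
    and m_unit: "\<And>j. j \<in> {1..q} \<Longrightarrow> \<exists>u. u * of_nat (m j) = (1 :: 'r)"
    and m_div: "\<And>j. j \<in> {1..q} \<Longrightarrow> of_nat (m j) * (z / of_nat (m j)) = z"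
  shows "growth_system z q m n f \<longleftrightarrow>
    map_mat hom (system_matrix q m n) *\<^sub>v vec (Suc q) f = unit_vec (Suc q) 0"
proof -
  interpret comm_ring_hom hom by fact
  have hom_if: "hom (if P then a else b) = (if P then hom a else hom b)" for P a b
    by simp
  have hom_pCons: "hom (pCons 0 p) = z * hom p" for p
    using hom_mult[of "[:0, 1:]" p] z by simp
  have row: "(map_mat hom (system_matrix q m n) *\<^sub>v vec (Suc q) f) $ j =
      (if j = 0 then f 0 else of_nat (m j) * f j - z * (\<Sum>i\<le>q. of_nat (n i j) * f i))"
    if "j \<le> q" for j
  proof -
    have "(map_mat hom (system_matrix q m n) *\<^sub>v vec (Suc q) f) $ j =
        (\<Sum>i<Suc q. hom (system_matrix q m n $$ (j, i)) * f i)"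
      using that by (simp add: system_matrix_def scalar_prod_def atLeast0LessThan)
    also have "\<dots> = (\<Sum>i\<le>q. hom (if j = 0 then (if i = 0 then 1 else 0)
        else (if i = j then of_nat (m j) else 0) - [:0, 1:] * of_nat (n i j)) * f i)"
      unfolding lessThan_Suc_atMost
      using that by (intro sum.cong) (auto simp: system_matrix_def)
    also have "\<dots> = (if j = 0 then f 0 else of_nat (m j) * f j - z * (\<Sum>i\<le>q. of_nat (n i j) * f i))"
    proof (cases "j = 0")
      case True
      then show ?thesis by (simp add: hom_if if_distrib[of "\<lambda>x. x * _"] sum.delta cong: if_cong)
    next
      case False
      have "(\<Sum>i\<le>q. hom ((if i = j then of_nat (m j) else 0) - [:0, 1:] * of_nat (n i j)) * f i)
          = (\<Sum>i\<le>q. (if i = j then of_nat (m j) * f j else 0) - z * (of_nat (n i j) * f i))"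
        by (intro sum.cong) (auto simp: hom_minus hom_pCons hom_of_nat algebra_simps)
      also have "\<dots> = of_nat (m j) * f j - z * (\<Sum>i\<le>q. of_nat (n i j) * f i)"
        using that by (simp add: sum_subtractf sum_distrib_left)
      finally show ?thesis using False by simp
    qed
    finally show ?thesis .
  qed
  \<comment> \<open>Multiplication by the unit \<open>m j\<close> is injective, so passing to the
    division-free equation loses nothing.\<close>
  have step: "f j = z / of_nat (m j) * F \<longleftrightarrow> of_nat (m j) * f j - z * F = 0"
    if "j \<in> {1..q}" for j F
  proof -
    obtain u where u: "u * of_nat (m j) = (1 :: 'r)" using m_unit[OF \<open>j \<in> {1..q}\<close>] by blast
    have cancel: "of_nat (m j) * a = of_nat (m j) * b \<longleftrightarrow> a = b" for a b :: 'r
      by (metis u mult.assoc mult_1)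
    have "f j = z / of_nat (m j) * F \<longleftrightarrow> of_nat (m j) * f j = of_nat (m j) * (z / of_nat (m j)) * F"
      by (simp add: mult.assoc cancel)
    then show ?thesis using m_div[OF \<open>j \<in> {1..q}\<close>] by simp
  qed
  have "map_mat hom (system_matrix q m n) *\<^sub>v vec (Suc q) f = unit_vec (Suc q) 0 \<longleftrightarrow>
      (\<forall>j\<le>q. (map_mat hom (system_matrix q m n) *\<^sub>v vec (Suc q) f) $ j = unit_vec (Suc q) 0 $ j)"
    by (auto simp: vec_eq_iff system_matrix_def less_Suc_eq_le)
  also have "\<dots> \<longleftrightarrow> (\<forall>j\<le>q. (if j = 0 then f 0
      else of_nat (m j) * f j - z * (\<Sum>i\<le>q. of_nat (n i j) * f i)) = (if j = 0 then 1 else 0))"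
    using row by (auto simp: less_Suc_eq_le)
  also have "\<dots> \<longleftrightarrow> f 0 = 1 \<and>
      (\<forall>j\<in>{1..q}. of_nat (m j) * f j - z * (\<Sum>i\<le>q. of_nat (n i j) * f i) = 0)"
    by (auto simp: Suc_le_eq)
  also have "\<dots> \<longleftrightarrow> growth_system z q m n f"
    unfolding growth_system_def using step by auto
  finally show ?thesis ..
qed

lemma map_mat_replace_col:
  fixes hom :: "'a \<Rightarrow> 'b"
  assumes "A \<in> carrier_mat k k" "b \<in> carrier_vec k"
  shows "map_mat hom (replace_col A b j) = replace_col (map_mat hom A) (map_vec hom b) j"
  using assms by (auto simp: replace_col_def)

text \<open>Cramer's rule forces the value of every solution once the determinant has an inverse
  \<open>u\<close>. For the converse the adjugate matrix supplies one solution \<open>x\<close>. By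
  the first half \<open>x\<close> has the forced values, so any \<open>f\<close> with these values
  agrees with \<open>x\<close> up to \<open>q\<close>.\<close>

lemma growth_system_iff_cramer:
  fixes hom :: "rat poly \<Rightarrow> 'r :: {comm_ring_1, inverse}"
  assumes "comm_ring_hom hom"
    and "hom [:0, 1:] = z"
    and "\<And>j. j \<in> {1..q} \<Longrightarrow> \<exists>u. u * of_nat (m j) = (1 :: 'r)"
    and "\<And>j. j \<in> {1..q} \<Longrightarrow> of_nat (m j) * (z / of_nat (m j)) = z"
    and unit: "u * hom (growth_denominator q m n) = 1"
  shows "growth_system z q m n f \<longleftrightarrow>
    (\<forall>j\<le>q. f j = u * hom (det (replace_col (system_matrix q m n) (unit_vec (Suc q) 0) j)))"
proof -
  interpret comm_ring_hom hom by fact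
  define A where "A = system_matrix q m n"
  define e :: "rat poly vec" where "e = unit_vec (Suc q) 0"
  define B where "B = map_mat hom A"
  have A: "A \<in> carrier_mat (Suc q) (Suc q)" by (simp add: A_def system_matrix_def)
  have B: "B \<in> carrier_mat (Suc q) (Suc q)" using A by (simp add: B_def)
  have e_carrier: "e \<in> carrier_vec (Suc q)" by (simp add: e_def)
  have e: "map_vec hom e = unit_vec (Suc q) 0" by (auto simp: e_def unit_vec_def)
  have iff: "growth_system z q m n g \<longleftrightarrow> B *\<^sub>v vec (Suc q) g = unit_vec (Suc q) 0" for g
    unfolding B_def A_def using assms(1-4) by (rule growth_system_iff_mult_vec)
  have detB: "u * det B = 1"
    using unit by (simp add: B_def A_def growth_denominator_def)
  have sol: "g j = u * hom (det (replace_col A e j))"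
    if "growth_system z q m n g" "j \<le> q" for g j
  proof -
    have "det (replace_col B (B *\<^sub>v vec (Suc q) g) j) = vec (Suc q) g $ j * det B"
      using B that by (intro cramer_lemma_mat) auto
    then have "g j * det B = det (replace_col B (map_vec hom e) j)"
      using that iff e by simp
    also have "\<dots> = hom (det (replace_col A e j))"
      using map_mat_replace_col[OF A e_carrier, of hom j] hom_det[of "replace_col A e j"]
      by (simp add: B_def del: hom_det)
    finally have "u * (g j * det B) = u * hom (det (replace_col A e j))" by simp
    moreover have "u * (g j * det B) = g j * (u * det B)" by (simp add: ac_simps)
    ultimately show ?thesis using detB by simp
  qed
  have adj: "adj_mat B \<in> carrier_mat (Suc q) (Suc q)" using adj_mat(1)[OF B] .
  \<comment> \<open>As \<open>u\<close> inverts \<open>det B\<close>, the matrix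
    \<open>u \<cdot>\<^sub>m adj_mat B\<close> is the inverse of \<open>B\<close>.\<close>
  define x where "x = (u \<cdot>\<^sub>m adj_mat B) *\<^sub>v unit_vec (Suc q) 0"
  have "B *\<^sub>v x = (B * (u \<cdot>\<^sub>m adj_mat B)) *\<^sub>v unit_vec (Suc q) 0"
    unfolding x_def using B adj by (intro assoc_mult_mat_vec[symmetric]) auto
  also have "B * (u \<cdot>\<^sub>m adj_mat B) = u \<cdot>\<^sub>m (det B \<cdot>\<^sub>m 1\<^sub>m (Suc q))"
    using mult_smult_distrib[OF B adj] adj_mat(2)[OF B] by simp
  also have "\<dots> = 1\<^sub>m (Suc q)"
    using detB by (intro eq_matI) (auto simp flip: mult.assoc)
  also have "\<dots> *\<^sub>v unit_vec (Suc q) 0 = unit_vec (Suc q) 0" by (rule one_mult_mat_vec) simp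
  finally have "B *\<^sub>v x = unit_vec (Suc q) 0" .
  moreover have "vec (Suc q) (\<lambda>j. x $ j) = x" using adj by (auto simp: x_def)
  ultimately have x: "growth_system z q m n (\<lambda>j. x $ j)" using iff by simp
  have "growth_system z q m n f" if "\<forall>j\<le>q. f j = u * hom (det (replace_col A e j))"
  proof -
    have "\<forall>j\<le>q. f j = x $ j" using that sol[OF x] by simp
    then have "vec (Suc q) f = vec (Suc q) (\<lambda>j. x $ j)" by auto
    then show ?thesis using x iff by simp
  qed
  then show ?thesis using sol unfolding A_def e_def by blast
qed

text \<open>The system constrains \<open>f\<close> only on \<open>{..q}\<close>. Fixing the values
  elsewhere by \<open>extensional\<close> turns the uniqueness of the solution into equality of
  functions.\<close>

lemma growth_system_ex1:
  fixes hom :: "rat poly \<Rightarrow> 'r :: {comm_ring_1, inverse}"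
  assumes "comm_ring_hom hom"
    and "hom [:0, 1:] = z"
    and "\<And>j. j \<in> {1..q} \<Longrightarrow> \<exists>u. u * of_nat (m j) = (1 :: 'r)"
    and "\<And>j. j \<in> {1..q} \<Longrightarrow> of_nat (m j) * (z / of_nat (m j)) = z"
    and "u * hom (growth_denominator q m n) = 1"
  shows "\<exists>!f. f \<in> extensional {..q} \<and> growth_system z q m n f"
proof -
  let ?s = "\<lambda>j. u * hom (det (replace_col (system_matrix q m n) (unit_vec (Suc q) 0) j))"
  have "growth_system z q m n f \<longleftrightarrow> (\<forall>j\<le>q. f j = ?s j)" for f
    using assms by (rule growth_system_iff_cramer)
  then show ?thesis
    by (intro ex1I[of _ "restrict ?s {..q}"]) (auto simp: extensional_def)
qed

lemma growth_system_sum: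
  fixes hom :: "rat poly \<Rightarrow> 'r :: {comm_ring_1, inverse}"
  assumes "comm_ring_hom hom"
    and "hom [:0, 1:] = z"
    and "\<And>j. j \<in> {1..q} \<Longrightarrow> \<exists>u. u * of_nat (m j) = (1 :: 'r)"
    and "\<And>j. j \<in> {1..q} \<Longrightarrow> of_nat (m j) * (z / of_nat (m j)) = z"
    and "u * hom (growth_denominator q m n) = 1"
    and "growth_system z q m n f"
  shows "(\<Sum>j\<le>q. f j) = u * hom (growth_numerator q m n)"
proof -
  interpret comm_ring_hom hom by fact
  have "growth_system z q m n f \<longleftrightarrow>
      (\<forall>j\<le>q. f j = u * hom (det (replace_col (system_matrix q m n) (unit_vec (Suc q) 0) j)))"
    using assms(1-5) by (rule growth_system_iff_cramer)
  then show ?thesis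
    using assms(6) by (simp add: growth_numerator_def hom_sum sum_distrib_left)
qed

text \<open>Taking the constant coefficient is a ring homomorphism and so commutes with
  \<open>det\<close>. It removes all multiples of the indeterminate and leaves the diagonal matrix
  with entries \<open>1, m 1, ..., m q\<close>.\<close>

lemma growth_denominator_constant_coeff:
  "coeff (growth_denominator q m n) 0 = (\<Prod>j = 1..q. of_nat (m j))"
proof -
  interpret comm_ring_hom "\<lambda>p :: rat poly. coeff p 0"
    by standard (auto simp: coeff_mult)
  let ?D = "map_mat (\<lambda>p. coeff p 0) (system_matrix q m n)"
  have entry: "?D $$ (j, i) = (if i = j then if j = 0 then 1 else of_nat (m j) else 0)"
    if "j \<le> q" "i \<le> q" for i j
    using that by (auto simp: system_matrix_def coeff_mult hom_distribs)
  have D: "?D \<in> carrier_mat (Suc q) (Suc q)" by (simp add: system_matrix_def)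
  have "det ?D = prod_list (diag_mat ?D)"
    using D entry by (intro det_upper_triangular) (auto simp: system_matrix_def less_Suc_eq_le upper_triangular_def simp del: index_map_mat(1))
  also have "diag_mat ?D = map (\<lambda>j. if j = 0 then 1 else of_nat (m j)) [0..<Suc q]"
    unfolding diag_mat_def using D by (intro map_cong) (auto simp: entry simp del: upt_Suc index_map_mat(1))
  also have "prod_list \<dots> = (\<Prod>j<Suc q. if j = 0 then 1 else of_nat (m j))"
    by (metis atLeast0LessThan atLeastLessThan_upt distinct_upt prod.distinct_set_conv_list)
  also have "\<dots> = (\<Prod>j = 1..q. of_nat (m j))"
    by (intro prod.mono_neutral_cong_right) auto
  finally show ?thesis by (simp add: growth_denominator_def)
qed

lemma comm_ring_hom_to_fract: "comm_ring_hom (to_fract :: 'a :: idom \<Rightarrow> 'a fract)"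
  by standard auto

lemma comm_ring_hom_fps_of_poly: "comm_ring_hom (fps_of_poly :: rat poly \<Rightarrow> rat fps)"
  by standard (auto simp: fps_of_poly_add fps_of_poly_mult)

text \<open>This is the algebraic half of the theorem, free of groups: \<open>F\<close> only has to
  be the sum of one power series solution. Since no \<open>m j\<close> vanishes, \<open>Q\<close>
  has nonzero constant coefficient. It is thus invertible in both rings, and both sums equal the
  same quotient \<open>P / Q\<close>.\<close>

lemma growth_system_solutions:
  fixes F :: "rat fps"
  assumes m: "\<And>j. j \<in> {1..q} \<Longrightarrow> m j \<noteq> 0"
    and f: "growth_system fps_X q m n f" and F: "F = (\<Sum>j\<le>q. f j)"
  defines "P \<equiv> growth_numerator q m n" and "Q \<equiv> growth_denominator q m n"
  shows "Q \<noteq> 0" "F * fps_of_poly Q = fps_of_poly P"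
    "\<exists>!f. f \<in> extensional {..q} \<and> growth_system ratfun_z q m n f"
    "growth_system ratfun_z q m n g \<Longrightarrow> expands_to (\<Sum>j\<le>q. g j) F"
    "\<exists>!f :: nat \<Rightarrow> rat fps. f \<in> extensional {..q} \<and> growth_system fps_X q m n f"
    "growth_system (fps_X :: rat fps) q m n h \<Longrightarrow> F = (\<Sum>j\<le>q. h j)"
proof -
  have Q0: "fps_nth (fps_of_poly Q) 0 \<noteq> 0"
    using m by (auto simp: Q_def growth_denominator_constant_coeff)
  then show Q: "Q \<noteq> 0" by auto
  \<comment> \<open>Division of power series is multiplication by the inverse when the divisor has
    nonzero constant coefficient, which is where \<open>m j \<noteq> 0\<close> enters.\<close>
  have fps_m: "inverse (of_nat (m j)) * of_nat (m j) = (1 :: rat fps)"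
      "of_nat (m j) * (fps_X / of_nat (m j)) = (fps_X :: rat fps)"
    if "j \<in> {1..q}" for j
  proof -
    have nz: "fps_nth (of_nat (m j) :: rat fps) 0 \<noteq> 0" using m[OF that] by simp
    then show inv: "inverse (of_nat (m j)) * of_nat (m j) = (1 :: rat fps)"
      by (rule inverse_mult_eq_1)
    show "of_nat (m j) * (fps_X / of_nat (m j)) = (fps_X :: rat fps)"
      unfolding fps_divide_unit[OF nz] using inv by (simp add: ac_simps)
  qed
  have inv: "inverse (fps_of_poly Q) * fps_of_poly Q = 1"
    using Q0 by (rule inverse_mult_eq_1)
  have fps_unit: "\<exists>u. u * of_nat (m j) = (1 :: rat fps)" if "j \<in> {1..q}" for j
    using fps_m(1)[OF that] by blast
  note fps = comm_ring_hom_fps_of_poly fps_of_poly_fps_X fps_unit fps_m(2) inv[unfolded Q_def]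
  have sum: "(\<Sum>j\<le>q. h j) = inverse (fps_of_poly Q) * fps_of_poly P"
    if "growth_system (fps_X :: rat fps) q m n h" for h
    unfolding P_def Q_def using fps that by (rule growth_system_sum)
  have "F * fps_of_poly Q = (inverse (fps_of_poly Q) * fps_of_poly Q) * fps_of_poly P"
    unfolding F sum[OF f] by (simp only: ac_simps)
  then show "F * fps_of_poly Q = fps_of_poly P" by (simp add: inv)
  then have exp: "expands_to (to_fract P / to_fract Q) F" unfolding expands_to_def using Q by blast
  show "\<exists>!f :: nat \<Rightarrow> rat fps. f \<in> extensional {..q} \<and> growth_system fps_X q m n f"
    using fps by (rule growth_system_ex1)
  show "F = (\<Sum>j\<le>q. h j)" if "growth_system (fps_X :: rat fps) q m n h"
    by (simp add: F sum[OF f] sum[OF that])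
  \<comment> \<open>The natural number is viewed as the image of a constant polynomial under the
    injective map \<open>to_fract\<close>.\<close>
  have fract_m: "(of_nat (m j) :: rat poly fract) \<noteq> 0" if "j \<in> {1..q}" for j
  proof -
    interpret comm_ring_hom "to_fract :: rat poly \<Rightarrow> rat poly fract" by (rule comm_ring_hom_to_fract)
    show ?thesis using m[OF that] by (metis hom_of_nat of_nat_eq_0_iff to_fract_eq_0_iff)
  qed
  have fr1: "\<exists>u. u * of_nat (m j) = (1 :: rat poly fract)" if "j \<in> {1..q}" for j
    using fract_m[OF that] by (intro exI[of _ "inverse (of_nat (m j))"]) simp
  have fr2: "of_nat (m j) * (ratfun_z / of_nat (m j)) = ratfun_z" if "j \<in> {1..q}" for j
    using fract_m[OF that] by simp
  have fr3: "inverse (to_fract Q) * to_fract Q = 1" using Q by simp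
  note fr = comm_ring_hom_to_fract ratfun_z_def[symmetric] fr1 fr2 fr3[unfolded Q_def]
  show "\<exists>!f. f \<in> extensional {..q} \<and> growth_system ratfun_z q m n f"
    using fr by (rule growth_system_ex1)
  show "expands_to (\<Sum>j\<le>q. g j) F" if "growth_system ratfun_z q m n g"
  proof -
    have "(\<Sum>j\<le>q. g j) = inverse (to_fract Q) * to_fract P"
      unfolding P_def Q_def using fr that by (rule growth_system_sum)
    then show ?thesis using exp by (simp add: divide_inverse mult.commute)
  qed
qed

section \<open>Extended cones\<close>

lemma cayley_graph_simps [simp]:
  "verts (cayley_graph G S) = carrier G" "ends (cayley_graph G S) = fst"
  by (simp_all add: cayley_graph_def)

section \<open>Walks and isomorphisms of multigraphs\<close>

lemma walk_snoc:
  assumes "walk \<Gamma> p" "y \<in> verts \<Gamma>" "e \<in> edges \<Gamma>" "ends \<Gamma> e = {last p, y}"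
  shows "walk \<Gamma> (p @ [y])"
proof -
  have "\<exists>e\<in>edges \<Gamma>. ends \<Gamma> e = {(p @ [y]) ! i, (p @ [y]) ! Suc i}"
    if "Suc i < length (p @ [y])" for i
  proof (cases "Suc i < length p")
    case True
    then show ?thesis using assms(1) by (auto simp: walk_def nth_append)
  next
    case False
    then have "length p = Suc i" using that by simp
    moreover from this have "last p = p ! i"
      by (metis diff_Suc_1 last_conv_nth length_0_conv nat.distinct(1))
    ultimately show ?thesis using assms(3,4) by (auto simp: nth_append)
  qed
  then show ?thesis using assms(1,2) by (auto simp: walk_def)
qed

lemma graph_iso_id: "graph_iso \<Gamma> \<Gamma> id id"
  by (simp add: graph_iso_def)

lemma graph_iso_comp:
  assumes "graph_iso \<Gamma> \<Gamma>' \<phi> \<psi>" "graph_iso \<Gamma>' \<Gamma>'' \<phi>' \<psi>'"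
  shows "graph_iso \<Gamma> \<Gamma>'' (\<phi>' \<circ> \<phi>) (\<psi>' \<circ> \<psi>)"
proof -
  have "\<psi> e \<in> edges \<Gamma>'" if "e \<in> edges \<Gamma>" for e
    using assms(1) that by (auto simp: graph_iso_def bij_betw_def)
  then show ?thesis
    using assms by (auto simp: graph_iso_def image_comp intro: bij_betw_trans)
qed

text \<open>\<open>inv_into\<close> undoes \<open>\<phi>\<close> only on the vertex set, so the
  endpoints of all edges have to be vertices. The record type of multigraphs does not enforce
  this.\<close>

lemma graph_iso_inv:
  assumes "graph_iso \<Gamma> \<Gamma>' \<phi> \<psi>" and wf: "\<And>e. e \<in> edges \<Gamma> \<Longrightarrow> ends \<Gamma> e \<subseteq> verts \<Gamma>"
  shows "graph_iso \<Gamma>' \<Gamma> (inv_into (verts \<Gamma>) \<phi>) (inv_into (edges \<Gamma>) \<psi>)"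
proof -
  have \<phi>: "bij_betw \<phi> (verts \<Gamma>) (verts \<Gamma>')" and \<psi>: "bij_betw \<psi> (edges \<Gamma>) (edges \<Gamma>')"
    and ends: "\<And>e. e \<in> edges \<Gamma> \<Longrightarrow> ends \<Gamma>' (\<psi> e) = \<phi> ` ends \<Gamma> e"
    using assms(1) by (auto simp: graph_iso_def)
  have "ends \<Gamma> (inv_into (edges \<Gamma>) \<psi> e) = inv_into (verts \<Gamma>) \<phi> ` ends \<Gamma>' e"
    if e: "e \<in> edges \<Gamma>'" for e
  proof -
    obtain d where d: "d \<in> edges \<Gamma>" "e = \<psi> d"
      using bij_betw_imp_surj_on[OF \<psi>] e by blast
    have "inv_into (verts \<Gamma>) \<phi> ` \<phi> ` ends \<Gamma> d = ends \<Gamma> d"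
      using \<phi> wf[OF d(1)] by (auto simp: bij_betw_def intro: inv_into_image_cancel)
    then show ?thesis using d ends \<psi> by (simp add: bij_betw_def)
  qed
  then show ?thesis
    using \<phi> \<psi> by (simp add: graph_iso_def bij_betw_inv_into)
qed

text \<open>This upgrades inclusions to equalities when an isomorphism and its inverse are both
  known to map one subset into the other.\<close>

lemma image_eq_if_right_inverse:
  assumes "f ` A \<subseteq> B" "f' ` B \<subseteq> A" "\<And>b. b \<in> B \<Longrightarrow> f (f' b) = b"
  shows "f ` A = B"
proof
  show "B \<subseteq> f ` A"
  proof
    fix b assume "b \<in> B"
    then have "f' b \<in> A" "b = f (f' b)" using assms(2,3) by auto
    then show "b \<in> f ` A" by (rule rev_image_eqI)
  qed
qed fact

text \<open>Strong equivalence with its two witnessing maps made explicit, so that they can be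
  inverted, composed and restricted to smaller cones.\<close>

definition cone_iso :: "('a, 'b) monoid_scheme \<Rightarrow> 'a set \<Rightarrow> 'a \<Rightarrow> 'a \<Rightarrow> ('a \<Rightarrow> 'a) \<Rightarrow>
    ('a set \<times> 'a \<Rightarrow> 'a set \<times> 'a) \<Rightarrow> bool" where
  "cone_iso G S g h \<phi> \<psi> \<longleftrightarrow>
     graph_iso (extended_cone G S g) (extended_cone G S h) \<phi> \<psi> \<and> \<phi> g = h \<and>
     \<phi> ` verts (cone G S g) = verts (cone G S h) \<and>
     \<psi> ` edges (cone G S g) = edges (cone G S h)"

lemma strongly_equivalent_iff: "strongly_equivalent G S g h \<longleftrightarrow> (\<exists>\<phi> \<psi>. cone_iso G S g h \<phi> \<psi>)"
  by (simp add: strongly_equivalent_def cone_iso_def)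

section \<open>Adjacency and word length in the Cayley graph\<close>

locale finitely_generated_group = group G for G (structure) +
  fixes S
  assumes finite_gens: "finite S" and gens_closed: "S \<subseteq> carrier G"
    and generate_gens: "generate G S = carrier G"
begin

abbreviation "len \<equiv> word_length G S"
abbreviation "\<Gamma> \<equiv> cayley_graph G S"

definition adj :: "'a \<Rightarrow> 'a \<Rightarrow> bool" where
  "adj u v \<longleftrightarrow> (\<exists>e\<in>edges \<Gamma>. fst e = {u, v})"

text \<open>One step of a geodesic leading away from the identity. The relation
  \<open>up\<^sup>*\<close> turns out to be membership in the cone, which replaces geodesics by
  induction over single steps.\<close>

definition up :: "('a \<times> 'a) set" where
  "up = {(u, v). adj u v \<and> len v = Suc (len u)}"

lemma adj_sym: "adj u v \<Longrightarrow> adj v u"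
  by (simp add: adj_def insert_commute)

lemma edge_ends_closed: "e \<in> edges \<Gamma> \<Longrightarrow> fst e \<subseteq> carrier G"
  using gens_closed by (auto simp: cayley_graph_def subset_iff)

lemma edge_ends: "e \<in> edges \<Gamma> \<Longrightarrow> x \<in> fst e \<Longrightarrow> \<exists>y. fst e = {x, y} \<and> adj x y"
proof -
  assume e: "e \<in> edges \<Gamma>" "x \<in> fst e"
  then obtain g s where gs: "fst e = {g, s \<otimes> g}" by (auto simp: cayley_graph_def)
  then obtain y where "fst e = {x, y}" using e(2) by (metis insert_commute insert_iff singletonD)
  then show ?thesis using e(1) by (auto simp: adj_def)
qed

lemma adj_closed: "adj u v \<Longrightarrow> u \<in> carrier G \<and> v \<in> carrier G"
  using edge_ends_closed by (fastforce simp: adj_def)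

text \<open>\<open>S\<close> need not be symmetric, but edges are undirected: an edge labelled
  \<open>s\<close> is left multiplication by \<open>s\<close> from one end and by
  \<open>inv s\<close> from the other.\<close>

lemma adj_iff:
  "adj u v \<longleftrightarrow> u \<in> carrier G \<and> (\<exists>s\<in>S. v = s \<otimes> u \<or> v = inv s \<otimes> u)"
proof
  assume "adj u v"
  then obtain g s where gs: "g \<in> carrier G" "s \<in> S" "{u, v} = {g, s \<otimes> g}"
    by (auto simp: adj_def cayley_graph_def)
  have "s \<in> carrier G" using gs gens_closed by auto
  then have "v = s \<otimes> u \<or> v = inv s \<otimes> u"
    using gs(1,3) by (auto simp: doubleton_eq_iff simp flip: m_assoc)
  then show "u \<in> carrier G \<and> (\<exists>s\<in>S. v = s \<otimes> u \<or> v = inv s \<otimes> u)"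
    using gs(2) adj_closed[OF \<open>adj u v\<close>] by blast
next
  assume R: "u \<in> carrier G \<and> (\<exists>s\<in>S. v = s \<otimes> u \<or> v = inv s \<otimes> u)"
  then obtain s where s: "s \<in> S" "v = s \<otimes> u \<or> v = inv s \<otimes> u" by blast
  have "s \<in> carrier G" using s gens_closed by auto
  have edge: "adj w (s \<otimes> w)" if "w \<in> carrier G" for w
    using s that by (auto simp: adj_def cayley_graph_def)
  from s(2) show "adj u v"
  proof
    assume "v = s \<otimes> u"
    then show ?thesis using edge[of u] R by simp
  next
    assume v: "v = inv s \<otimes> u"
    moreover have "u \<in> carrier G" using R ..
    ultimately have "v \<in> carrier G" "u = s \<otimes> v"
      using \<open>s \<in> carrier G\<close> by (simp_all flip: m_assoc)
    then have "adj v u" using edge[of v] by simp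
    then show ?thesis by (rule adj_sym)
  qed
qed

lemma letters_closed: "S \<union> m_inv G ` S \<subseteq> carrier G"
  using gens_closed by auto

lemma word_closed:
  "set w \<subseteq> S \<union> m_inv G ` S \<Longrightarrow> foldr (\<lambda>x y. x \<otimes> y) w \<one> \<in> carrier G"
  using letters_closed by (induction w) auto

lemma word_append:
  "set v \<subseteq> S \<union> m_inv G ` S \<Longrightarrow> set w \<subseteq> S \<union> m_inv G ` S \<Longrightarrow>
    foldr (\<lambda>x y. x \<otimes> y) (v @ w) \<one> = foldr (\<lambda>x y. x \<otimes> y) v \<one> \<otimes> foldr (\<lambda>x y. x \<otimes> y) w \<one>"
proof (induction v)
  case Nil
  then show ?case using word_closed by simp
next
  case (Cons a v)
  then show ?case using word_closed[of v] word_closed[of w] letters_closed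
    by (auto simp: m_assoc subset_iff)
qed

lemma ex_word:
  assumes "g \<in> carrier G"
  shows "\<exists>w. set w \<subseteq> S \<union> m_inv G ` S \<and> foldr (\<lambda>x y. x \<otimes> y) w \<one> = g"
proof -
  have "g \<in> generate G S" using assms generate_gens by simp
  then show ?thesis
  proof induction
    case one
    then show ?case by (intro exI[of _ "[]"]) simp
  next
    case (incl h)
    then show ?case using gens_closed by (intro exI[of _ "[h]"]) auto
  next
    case (inv h)
    then show ?case using gens_closed by (intro exI[of _ "[inv h]"]) auto
  next
    case (eng h1 h2)
    then obtain v w where "set v \<subseteq> S \<union> m_inv G ` S" "foldr (\<lambda>x y. x \<otimes> y) v \<one> = h1"
      "set w \<subseteq> S \<union> m_inv G ` S" "foldr (\<lambda>x y. x \<otimes> y) w \<one> = h2" by blast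
    then show ?case using word_append by (intro exI[of _ "v @ w"]) auto
  qed
qed

lemma len_word_le:
  "set w \<subseteq> S \<union> m_inv G ` S \<Longrightarrow> len (foldr (\<lambda>x y. x \<otimes> y) w \<one>) \<le> length w"
  unfolding word_length_def by (rule Least_le) blast

lemma ex_shortest_word:
  assumes "g \<in> carrier G"
  shows "\<exists>w. set w \<subseteq> S \<union> m_inv G ` S \<and> length w = len g \<and> foldr (\<lambda>x y. x \<otimes> y) w \<one> = g"
  unfolding word_length_def by (rule LeastI_ex) (use ex_word[OF assms] in blast)

lemma len_one [simp]: "len \<one> = 0"
  using len_word_le[of "[]"] by simp

lemma len_eq_0: "g \<in> carrier G \<Longrightarrow> len g = 0 \<Longrightarrow> g = \<one>"
  using ex_shortest_word by fastforce

lemma adj_len_le: 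
  assumes "adj u v" shows "len v \<le> Suc (len u)"
proof -
  obtain x where x: "x \<in> S \<union> m_inv G ` S" "v = x \<otimes> u" using assms by (auto simp: adj_iff)
  obtain w where w: "set w \<subseteq> S \<union> m_inv G ` S" "length w = len u" "foldr (\<lambda>x y. x \<otimes> y) w \<one> = u"
    using ex_shortest_word adj_closed[OF assms] by blast
  show ?thesis using len_word_le[of "x # w"] x w by simp
qed

text \<open>Removing the first letter of a shortest word for \<open>g\<close> gives a neighbour,
  because the left Cayley graph multiplies by letters from the left.\<close>

lemma ex_up_step:
  assumes "g \<in> carrier G" "g \<noteq> \<one>"
  shows "\<exists>h. (h, g) \<in> up"
proof -
  obtain w where w: "set w \<subseteq> S \<union> m_inv G ` S" "length w = len g" "foldr (\<lambda>x y. x \<otimes> y) w \<one> = g"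
    using ex_shortest_word assms by blast
  then obtain x v where xv: "w = x # v" using assms by (cases w) auto
  define h where "h = foldr (\<lambda>x y. x \<otimes> y) v \<one>"
  have "len h \<le> length v" unfolding h_def using w xv by (intro len_word_le) auto
  moreover have "h \<in> carrier G" unfolding h_def using w xv by (intro word_closed) auto
  moreover have "x \<in> S \<union> m_inv G ` S" "g = x \<otimes> h" using w xv by (auto simp: h_def)
  ultimately have "adj h g" "len h \<le> length v" by (auto simp: adj_iff)
  \<comment> \<open>The shorter word bounds \<open>len h\<close> from above and adjacency bounds it
    from below, so it is exactly one less than \<open>len g\<close>.\<close>
  then have "(h, g) \<in> up" using adj_len_le[of h g] w(2) xv by (auto simp: up_def)
  then show ?thesis ..
qed

lemma up_closed: "(u, v) \<in> up \<Longrightarrow> u \<in> carrier G \<and> v \<in> carrier G"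
  using adj_closed[of u v] by (simp add: up_def)

lemma up_rtrancl_closed: "(u, v) \<in> up\<^sup>* \<Longrightarrow> u \<in> carrier G \<Longrightarrow> v \<in> carrier G"
  by (induction rule: rtrancl_induct) (auto dest: up_closed)

lemma up_rtrancl_len_le: "(u, v) \<in> up\<^sup>* \<Longrightarrow> len u \<le> len v"
  by (induction rule: rtrancl_induct) (auto simp: up_def)

lemma one_up_rtrancl: "g \<in> carrier G \<Longrightarrow> (\<one>, g) \<in> up\<^sup>*"
proof (induction "len g" arbitrary: g rule: less_induct)
  case less
  show ?case
  proof (cases "g = \<one>")
    case False
    then obtain h where h: "(h, g) \<in> up" using ex_up_step less.prems by blast
    then have "(\<one>, h) \<in> up\<^sup>*" using less.hyps[of h] up_closed[OF h] by (auto simp: up_def)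
    then show ?thesis using h by simp
  qed simp
qed

section \<open>Geodesics from the identity and the vertices of cones\<close>

lemma walk_len_le:
  assumes "walk \<Gamma> p" "i \<le> j" "j < length p"
  shows "len (p ! j) \<le> len (p ! i) + (j - i)"
  using assms(2,3)
proof (induction j rule: dec_induct)
  case (step k)
  have "adj (p ! k) (p ! Suc k)"
    using assms(1) step by (auto simp: walk_def adj_def)
  then show ?case using adj_len_le step by fastforce
qed simp

text \<open>For a walk starting at the identity, the length hypothesis says that it is geodesic, and
  up steps keep it so. The inclusion of vertex sets records that a vertex passed earlier stays on
  the extended walk.\<close>

lemma walk_extend_up:
  assumes "(last p, h) \<in> up\<^sup>*" "walk \<Gamma> p" "length p = Suc (len (last p))"
  shows "\<exists>p'. walk \<Gamma> p' \<and> hd p' = hd p \<and> last p' = h \<and> length p' = Suc (len h) \<and> set p \<subseteq> set p'"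
  using assms(1)
proof (induction rule: rtrancl_induct)
  case base
  then show ?case using assms by blast
next
  case (step y z)
  then obtain p' where p': "walk \<Gamma> p'" "hd p' = hd p" "last p' = y" "length p' = Suc (len y)"
    "set p \<subseteq> set p'" by blast
  obtain e where e: "e \<in> edges \<Gamma>" "fst e = {y, z}" "len z = Suc (len y)"
    using step(2) by (auto simp: up_def adj_def)
  have "walk \<Gamma> (p' @ [z])"
    using p' e up_closed[OF step(2)] by (intro walk_snoc[of _ _ _ e]) auto
  moreover have "p' \<noteq> []" using p'(4) by auto
  ultimately show ?case using p' e by (intro exI[of _ "p' @ [z]"]) auto
qed

text \<open>A walk is a list of vertices, hence the \<open>Suc\<close>. No walk is shorter, since
  each step raises the word length by at most one, and walking up from the identity attains the
  bound.\<close>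

lemma geodesic_one_iff:
  assumes "h \<in> carrier G"
  shows "geodesic \<Gamma> \<one> h p \<longleftrightarrow> walk \<Gamma> p \<and> hd p = \<one> \<and> last p = h \<and> length p = Suc (len h)"
proof -
  have lower: "Suc (len h) \<le> length p'" if "walk \<Gamma> p'" "hd p' = \<one>" "last p' = h" for p'
  proof -
    have "p' \<noteq> []" using that by (simp add: walk_def)
    then show ?thesis
      using walk_len_le[OF that(1), of 0 "length p' - 1"] that(2,3)
      by (cases p') (auto simp: hd_conv_nth last_conv_nth)
  qed
  have "walk \<Gamma> [\<one>]" by (simp add: walk_def)
  then obtain p' where "walk \<Gamma> p'" "hd p' = \<one>" "last p' = h" "length p' = Suc (len h)"
    using walk_extend_up[of "[\<one>]" h] one_up_rtrancl[OF assms] by auto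
  then show ?thesis using lower unfolding geodesic_def by (metis le_antisym)
qed

text \<open>Along a geodesic from the identity the word length rises by one at each step, so the
  part after \<open>g\<close> consists of up steps. Conversely, a geodesic to \<open>g\<close>
  extended by up steps is a geodesic through \<open>g\<close>.\<close>

lemma verts_cone:
  assumes "g \<in> carrier G"
  shows "verts (cone G S g) = {h. (g, h) \<in> up\<^sup>*}"
proof -
  have "(g, h) \<in> up\<^sup>*" if "h \<in> carrier G" "geodesic \<Gamma> \<one> h p" and gp: "g \<in> set p" for h p
  proof -
    have p: "walk \<Gamma> p" "hd p = \<one>" "last p = h" "length p = Suc (len h)"
      using that geodesic_one_iff by auto
    then have "p ! 0 = \<one>" "p ! len h = h" by (auto simp: hd_conv_nth last_conv_nth simp flip: length_greater_0_conv)
    \<comment> \<open>The first \<open>k\<close> steps give the upper bound, the remaining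
      \<open>len h - k\<close> steps the lower one.\<close>
    then have len_nth: "len (p ! k) = k" if "k \<le> len h" for k
      using walk_len_le[OF p(1), of 0 k] walk_len_le[OF p(1), of k "len h"] p(4) that by simp
    obtain i where i: "i \<le> len h" "p ! i = g"
      using gp p(4) by (auto simp: in_set_conv_nth less_Suc_eq_le)
    have "j \<le> len h \<longrightarrow> (p ! i, p ! j) \<in> up\<^sup>*" if "i \<le> j" for j
      using that
    proof (induction j rule: dec_induct)
      case (step k)
      have "(p ! k, p ! Suc k) \<in> up" if "Suc k \<le> len h"
        using p(1,4) that len_nth[of k] len_nth[of "Suc k"] by (auto simp: walk_def up_def adj_def)
      then show ?case using step by (auto intro: rtrancl_into_rtrancl)
    qed simp
    from this[OF i(1)] show ?thesis using i(2) \<open>p ! len h = h\<close> by simp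
  qed
  moreover have "\<exists>p. geodesic \<Gamma> \<one> h p \<and> g \<in> set p" if gh: "(g, h) \<in> up\<^sup>*" for h
  proof -
    have "walk \<Gamma> [\<one>]" by (simp add: walk_def)
    then obtain p where p: "walk \<Gamma> p" "hd p = \<one>" "last p = g" "length p = Suc (len g)"
      using walk_extend_up[of "[\<one>]" g] one_up_rtrancl[OF assms] by auto
    then obtain p' where "walk \<Gamma> p'" "hd p' = \<one>" "last p' = h" "length p' = Suc (len h)" "set p \<subseteq> set p'"
      using walk_extend_up[of p h] gh by auto
    moreover have "g \<in> set p" using p by (auto simp: walk_def)
    moreover have "h \<in> carrier G" using gh assms by (rule up_rtrancl_closed)
    ultimately show ?thesis using geodesic_one_iff by blast
  qed
  ultimately show ?thesis
    using up_rtrancl_closed assms by (auto simp: cone_def induced_subgraph_def)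
qed

lemma edges_cone:
  assumes "g \<in> carrier G"
  shows "edges (cone G S g) = {e \<in> edges \<Gamma>. fst e \<subseteq> {h. (g, h) \<in> up\<^sup>*}}"
proof -
  have "edges (cone G S g) = {e \<in> edges \<Gamma>. fst e \<subseteq> verts (cone G S g)}"
    using edge_ends_closed by (auto simp: cone_def induced_subgraph_def)
  then show ?thesis by (simp add: verts_cone assms)
qed

abbreviation tangent_edges :: "'a \<Rightarrow> ('a set \<times> 'a) set" where
  "tangent_edges g \<equiv> (\<Union>h\<in>{h. (g, h) \<in> up\<^sup>*}. tangent_edges_at G S h)"

lemma extended_cone_simps:
  assumes "g \<in> carrier G"
  shows "verts (extended_cone G S g) = {h. (g, h) \<in> up\<^sup>*} \<union> (\<Union>e\<in>tangent_edges g. fst e)"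
    "edges (extended_cone G S g) = edges (cone G S g) \<union> tangent_edges g"
    "ends (extended_cone G S g) = fst"
  by (simp_all add: extended_cone_def Let_def verts_cone assms)

lemma edges_extended_cone_subset: "g \<in> carrier G \<Longrightarrow> edges (extended_cone G S g) \<subseteq> edges \<Gamma>"
  by (auto simp: extended_cone_simps edges_cone tangent_edges_at_def)

lemma ends_extended_cone:
  assumes "g \<in> carrier G" "e \<in> edges (extended_cone G S g)"
  shows "fst e \<subseteq> verts (extended_cone G S g)"
  using assms(2) by (auto simp: extended_cone_simps edges_cone assms(1))

lemma tangent_edges_at_iff:
  "e \<in> tangent_edges_at G S x \<longleftrightarrow> e \<in> edges \<Gamma> \<and> (\<exists>y. fst e = {x, y} \<and> len y = len x)"
  by (simp add: tangent_edges_at_def)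

section \<open>Isomorphisms of extended cones and their restrictions\<close>

lemma cone_iso_refl: "cone_iso G S g g id id"
  by (simp add: cone_iso_def graph_iso_id)

lemma cone_iso_comp:
  "cone_iso G S g h \<phi> \<psi> \<Longrightarrow> cone_iso G S h k \<phi>' \<psi>' \<Longrightarrow> cone_iso G S g k (\<phi>' \<circ> \<phi>) (\<psi>' \<circ> \<psi>)"
  unfolding cone_iso_def image_comp[symmetric] by (auto intro: graph_iso_comp)

text \<open>The four cancellation laws are part of the result because later inequalities and
  inclusions are proved in one direction and then applied to the inverse maps as well.\<close>

lemma cone_iso_inv:
  assumes "cone_iso G S g h \<phi> \<psi>" "g \<in> carrier G"
  obtains \<phi>' \<psi>' where "cone_iso G S h g \<phi>' \<psi>'"
    "\<And>x. x \<in> verts (extended_cone G S g) \<Longrightarrow> \<phi>' (\<phi> x) = x"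
    "\<And>x. x \<in> verts (extended_cone G S h) \<Longrightarrow> \<phi> (\<phi>' x) = x"
    "\<And>e. e \<in> edges (extended_cone G S g) \<Longrightarrow> \<psi>' (\<psi> e) = e"
    "\<And>e. e \<in> edges (extended_cone G S h) \<Longrightarrow> \<psi> (\<psi>' e) = e"
proof -
  let ?V = "verts (extended_cone G S g)" and ?E = "edges (extended_cone G S g)"
  let ?\<phi> = "inv_into ?V \<phi>" and ?\<psi> = "inv_into ?E \<psi>"
  have iso: "graph_iso (extended_cone G S g) (extended_cone G S h) \<phi> \<psi>" "\<phi> g = h"
    "\<phi> ` verts (cone G S g) = verts (cone G S h)" "\<psi> ` edges (cone G S g) = edges (cone G S h)"
    using assms(1) by (auto simp: cone_iso_def)
  have bij: "bij_betw \<phi> ?V (verts (extended_cone G S h))" "bij_betw \<psi> ?E (edges (extended_cone G S h))"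
    using iso(1) by (auto simp: graph_iso_def)
  have sub: "verts (cone G S g) \<subseteq> ?V" "edges (cone G S g) \<subseteq> ?E" "g \<in> ?V"
    using assms(2) by (auto simp: extended_cone_simps verts_cone)
  have left: "?\<phi> (\<phi> x) = x" if "x \<in> ?V" for x
    using bij(1) that by (simp add: bij_betw_def)
  have left': "?\<psi> (\<psi> e) = e" if "e \<in> ?E" for e
    using bij(2) that by (simp add: bij_betw_def)
  have "graph_iso (extended_cone G S h) (extended_cone G S g) ?\<phi> ?\<psi>"
    using iso(1) ends_extended_cone[OF assms(2)] extended_cone_simps(3)[OF assms(2)]
    by (intro graph_iso_inv) simp_all
  moreover have "?\<phi> h = g" using left[OF sub(3)] iso(2) by simp
  moreover have "?\<phi> ` verts (cone G S h) = verts (cone G S g)"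
    unfolding iso(3)[symmetric] using bij(1) sub(1) by (simp add: bij_betw_def inv_into_image_cancel)
  moreover have "?\<psi> ` edges (cone G S h) = edges (cone G S g)"
    unfolding iso(4)[symmetric] using bij(2) sub(2) by (simp add: bij_betw_def inv_into_image_cancel)
  ultimately have "cone_iso G S h g ?\<phi> ?\<psi>" by (simp add: cone_iso_def)
  then show ?thesis
    using left left' bij by (intro that) (auto simp: bij_betw_def f_inv_into_f)
qed

lemma strongly_equivalent_sym:
  "strongly_equivalent G S g h \<Longrightarrow> g \<in> carrier G \<Longrightarrow> strongly_equivalent G S h g"
  unfolding strongly_equivalent_iff by (blast elim: cone_iso_inv)

lemma strongly_equivalent_trans:
  "strongly_equivalent G S g h \<Longrightarrow> strongly_equivalent G S h k \<Longrightarrow> strongly_equivalent G S g k"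
  unfolding strongly_equivalent_iff by (blast intro: cone_iso_comp)

lemma equiv_strongly_equivalent:
  "equiv (carrier G) {(g, h). g \<in> carrier G \<and> h \<in> carrier G \<and> strongly_equivalent G S g h}"
proof (intro equivI)
  show "refl_on (carrier G) {(g, h). g \<in> carrier G \<and> h \<in> carrier G \<and> strongly_equivalent G S g h}"
    using cone_iso_refl by (auto simp: refl_on_def strongly_equivalent_iff)
  show "sym {(g, h). g \<in> carrier G \<and> h \<in> carrier G \<and> strongly_equivalent G S g h}"
    unfolding strongly_equivalent_iff sym_def by (blast elim: cone_iso_inv)
  show "trans {(g, h). g \<in> carrier G \<and> h \<in> carrier G \<and> strongly_equivalent G S g h}"
    unfolding strongly_equivalent_iff trans_def by (blast intro: cone_iso_comp)
qed auto

lemma cone_iso_ends: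
  assumes "cone_iso G S g h \<phi> \<psi>" "g \<in> carrier G" "h \<in> carrier G" "e \<in> edges (extended_cone G S g)"
  shows "\<psi> e \<in> edges (extended_cone G S h)" "\<psi> e \<in> edges \<Gamma>" "fst (\<psi> e) = \<phi> ` fst e"
proof -
  show E: "\<psi> e \<in> edges (extended_cone G S h)" 
    using assms(1,4) by (auto simp: cone_iso_def graph_iso_def bij_betw_def)
  then show "\<psi> e \<in> edges \<Gamma>" using edges_extended_cone_subset assms(3) by blast
  show "fst (\<psi> e) = \<phi> ` fst e"
    using assms by (auto simp: cone_iso_def graph_iso_def extended_cone_simps)
qed

lemma up_edge_in_cone:
  assumes "g \<in> carrier G" "(g, x) \<in> up\<^sup>*" "(x, y) \<in> up" "e \<in> edges \<Gamma>" "fst e = {x, y}"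
  shows "e \<in> edges (extended_cone G S g)"
  using assms by (auto simp: extended_cone_simps edges_cone intro: rtrancl_into_rtrancl)

lemma cone_iso_adj:
  assumes "cone_iso G S g h \<phi> \<psi>" "g \<in> carrier G" "h \<in> carrier G" "(g, x) \<in> up\<^sup>*" "(x, y) \<in> up"
  shows "adj (\<phi> x) (\<phi> y)"
proof -
  obtain e where e: "e \<in> edges \<Gamma>" "fst e = {x, y}" using assms(5) by (auto simp: up_def adj_def)
  have "e \<in> edges (extended_cone G S g)" using up_edge_in_cone assms e by blast
  then have "\<psi> e \<in> edges \<Gamma>" "fst (\<psi> e) = {\<phi> x, \<phi> y}" using cone_iso_ends[OF assms(1-3)] e by auto
  then show ?thesis by (auto simp: adj_def)
qed

text \<open>Each up step from \<open>g\<close> is mapped to an edge, along which the length grows by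
  at most one. The additive form avoids truncated subtraction.\<close>

lemma cone_iso_len_le:
  assumes "cone_iso G S g h \<phi> \<psi>" "g \<in> carrier G" "h \<in> carrier G" "(g, x) \<in> up\<^sup>*"
  shows "len (\<phi> x) + len g \<le> len x + len h"
  using assms(4)
proof (induction rule: rtrancl_induct)
  case base
  then show ?case using assms(1) by (simp add: cone_iso_def)
next
  case (step x y)
  then show ?case using adj_len_le[OF cone_iso_adj[OF assms(1-3) step(1,2)]] by (simp add: up_def)
qed

lemma cone_iso_mem:
  assumes "cone_iso G S g h \<phi> \<psi>" "g \<in> carrier G" "h \<in> carrier G" "(g, x) \<in> up\<^sup>*"
  shows "(h, \<phi> x) \<in> up\<^sup>*"
  using assms by (auto simp: cone_iso_def verts_cone)

lemma cone_subset_extended_cone: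
  "g \<in> carrier G \<Longrightarrow> (g, x) \<in> up\<^sup>* \<Longrightarrow> x \<in> verts (extended_cone G S g)"
  by (simp add: extended_cone_simps)

text \<open>The reverse inequality is the previous one for the inverse isomorphism at
  \<open>\<phi> x\<close>.\<close>

lemma cone_iso_len:
  assumes "cone_iso G S g h \<phi> \<psi>" "g \<in> carrier G" "h \<in> carrier G" "(g, x) \<in> up\<^sup>*"
  shows "len (\<phi> x) + len g = len x + len h"
proof -
  obtain \<phi>' \<psi>' where inv: "cone_iso G S h g \<phi>' \<psi>'"
    "\<And>x. x \<in> verts (extended_cone G S g) \<Longrightarrow> \<phi>' (\<phi> x) = x"
    by (rule cone_iso_inv[OF assms(1,2)]) blast
  have "len (\<phi>' (\<phi> x)) + len h \<le> len (\<phi> x) + len g"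
    using inv(1) assms(3,2) cone_iso_mem[OF assms] by (rule cone_iso_len_le)
  then show ?thesis
    using inv(2) cone_subset_extended_cone assms(2,4) cone_iso_len_le[OF assms] by simp
qed

lemma cone_iso_up:
  assumes "cone_iso G S g h \<phi> \<psi>" "g \<in> carrier G" "h \<in> carrier G" "(g, x) \<in> up\<^sup>*" "(x, y) \<in> up"
  shows "(\<phi> x, \<phi> y) \<in> up"
  using cone_iso_adj[OF assms] cone_iso_len[OF assms(1-4)]
    cone_iso_len[OF assms(1-3) rtrancl_into_rtrancl[OF assms(4,5)]] assms(5)
  by (simp add: up_def)

lemma cone_iso_up_rtrancl:
  assumes "cone_iso G S g h \<phi> \<psi>" "g \<in> carrier G" "h \<in> carrier G" "(g, x) \<in> up\<^sup>*" "(x, y) \<in> up\<^sup>*"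
  shows "(\<phi> x, \<phi> y) \<in> up\<^sup>*"
  using assms(5)
proof (induction rule: rtrancl_induct)
  case (step y z)
  then have "(\<phi> y, \<phi> z) \<in> up" using cone_iso_up[OF assms(1-3)] assms(4) by (meson rtrancl_trans)
  then show ?case using step by simp
qed simp

lemma cone_iso_tangent:
  assumes "cone_iso G S g h \<phi> \<psi>" "g \<in> carrier G" "h \<in> carrier G" "(g, x) \<in> up\<^sup>*"
    and "e \<in> tangent_edges_at G S x"
  shows "\<psi> e \<in> tangent_edges_at G S (\<phi> x)"
proof -
  obtain y where y: "e \<in> edges \<Gamma>" "fst e = {x, y}" "len y = len x"
    using assms(5) by (auto simp: tangent_edges_at_iff)
  have ext: "e \<in> edges (extended_cone G S g)"
    using assms by (auto simp: extended_cone_simps)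
  note \<psi> = cone_iso_ends[OF assms(1-3) ext]
  have "len (\<phi> y) = len (\<phi> x)"
  proof (cases "e \<in> edges (cone G S g)")
    case True
    then have "(g, y) \<in> up\<^sup>*" using y assms(2) by (auto simp: edges_cone)
    then show ?thesis
      using cone_iso_len[OF assms(1-3)] assms(4) y(3) by (metis add_right_cancel)
  next
    \<comment> \<open>The far end \<open>y\<close> lies outside the cone, where lengths are not
      controlled. But \<open>\<psi>\<close> is injective and matches the edges of the two cones, so
      \<open>\<psi> e\<close> is no cone edge either, and all other edges of an extended cone are
      tangent.\<close>
    case False
    have "inj_on \<psi> (edges (extended_cone G S g))" "\<psi> ` edges (cone G S g) = edges (cone G S h)"
      using assms(1) by (auto simp: cone_iso_def graph_iso_def bij_betw_def)
    moreover have "edges (cone G S g) \<subseteq> edges (extended_cone G S g)"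
      using assms(2) by (auto simp: extended_cone_simps)
    ultimately have "\<psi> e \<notin> edges (cone G S h)"
      using False ext by (metis inj_on_image_mem_iff)
    then obtain k k' where "fst (\<psi> e) = {k, k'}" "len k' = len k"
      using \<psi>(1) assms(3) by (auto simp: extended_cone_simps tangent_edges_at_iff)
    moreover have "fst (\<psi> e) = {\<phi> x, \<phi> y}" using \<psi>(3) y(2) by simp
    ultimately show ?thesis by (auto simp: doubleton_eq_iff)
  qed
  then show ?thesis using \<psi> y(2) by (auto simp: tangent_edges_at_iff)
qed

lemma cone_iso_restrict_image:
  assumes "cone_iso G S g h \<phi> \<psi>" "g \<in> carrier G" "h \<in> carrier G" "(g, x) \<in> up\<^sup>*"
  shows "\<phi> ` {y. (x, y) \<in> up\<^sup>*} \<subseteq> {y. (\<phi> x, y) \<in> up\<^sup>*}"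
    "\<psi> ` edges (cone G S x) \<subseteq> edges (cone G S (\<phi> x))"
    "\<psi> ` tangent_edges x \<subseteq> tangent_edges (\<phi> x)"
proof -
  show V: "\<phi> ` {y. (x, y) \<in> up\<^sup>*} \<subseteq> {y. (\<phi> x, y) \<in> up\<^sup>*}"
    using cone_iso_up_rtrancl[OF assms] by blast
  have x: "x \<in> carrier G" "\<phi> x \<in> carrier G"
    using assms cone_iso_mem[OF assms] up_rtrancl_closed by blast+
  show "\<psi> ` edges (cone G S x) \<subseteq> edges (cone G S (\<phi> x))"
  proof
    fix d assume "d \<in> \<psi> ` edges (cone G S x)"
    then obtain e where e: "d = \<psi> e" "e \<in> edges \<Gamma>" "fst e \<subseteq> {y. (x, y) \<in> up\<^sup>*}"
      using x by (auto simp: edges_cone)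
    have "e \<in> edges (extended_cone G S g)"
      using e assms(2,4) by (auto simp: extended_cone_simps edges_cone intro: rtrancl_trans)
    note \<psi> = cone_iso_ends[OF assms(1-3) this]
    have "fst (\<psi> e) \<subseteq> {y. (\<phi> x, y) \<in> up\<^sup>*}" unfolding \<psi>(3) using e(3) V by blast
    then show "d \<in> edges (cone G S (\<phi> x))" using \<psi>(2) e(1) x by (simp add: edges_cone)
  qed
  show "\<psi> ` tangent_edges x \<subseteq> tangent_edges (\<phi> x)"
  proof
    fix d assume "d \<in> \<psi> ` tangent_edges x"
    then obtain e y where e: "d = \<psi> e" "(x, y) \<in> up\<^sup>*" "e \<in> tangent_edges_at G S y" by blast
    have "(g, y) \<in> up\<^sup>*" using assms(4) e(2) by (rule rtrancl_trans)
    then show "d \<in> tangent_edges (\<phi> x)" using cone_iso_tangent[OF assms(1-3)] e V by blast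
  qed
qed

text \<open>The maps send the extended cone of \<open>x\<close> into that of
  \<open>\<phi> x\<close>, and the inverse maps, applied at \<open>\<phi> x\<close>, lead back.
  Strong equivalence is thereby inherited by all vertices of the cone, in particular by the upper
  ends of the edges counted by \<open>cone_n\<close>.\<close>

lemma cone_iso_restrict:
  assumes "cone_iso G S g h \<phi> \<psi>" "g \<in> carrier G" "h \<in> carrier G" "(g, x) \<in> up\<^sup>*"
  shows "cone_iso G S x (\<phi> x) \<phi> \<psi>"
proof -
  obtain \<phi>' \<psi>' where inv: "cone_iso G S h g \<phi>' \<psi>'"
    "\<And>x. x \<in> verts (extended_cone G S g) \<Longrightarrow> \<phi>' (\<phi> x) = x"
    "\<And>x. x \<in> verts (extended_cone G S h) \<Longrightarrow> \<phi> (\<phi>' x) = x"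
    "\<And>e. e \<in> edges (extended_cone G S g) \<Longrightarrow> \<psi>' (\<psi> e) = e"
    "\<And>e. e \<in> edges (extended_cone G S h) \<Longrightarrow> \<psi> (\<psi>' e) = e"
    by (rule cone_iso_inv[OF assms(1,2)]) blast
  note fx = cone_iso_mem[OF assms]
  have x: "x \<in> carrier G" "\<phi> x \<in> carrier G"
    using assms fx up_rtrancl_closed by blast+
  have x': "\<phi>' (\<phi> x) = x" using inv(2) assms cone_subset_extended_cone by blast
  note im = cone_iso_restrict_image[OF assms]
  note im' = cone_iso_restrict_image[OF inv(1) assms(3,2) fx, unfolded x']
  \<comment> \<open>Nesting of extended cones makes injectivity and the cancellation laws of the
    large cones available on the small ones.\<close>
  have sub: "verts (extended_cone G S y) \<subseteq> verts (extended_cone G S k)"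
    "edges (extended_cone G S y) \<subseteq> edges (extended_cone G S k)"
    if "k \<in> carrier G" "(k, y) \<in> up\<^sup>*" for k y
  proof -
    have y: "y \<in> carrier G" using up_rtrancl_closed[OF that(2,1)] .
    have V: "{z. (y, z) \<in> up\<^sup>*} \<subseteq> {z. (k, z) \<in> up\<^sup>*}"
      using that(2) by (auto intro: rtrancl_trans)
    have E: "edges (cone G S y) \<subseteq> edges (cone G S k)"
      unfolding edges_cone[OF y] edges_cone[OF that(1)] using V by blast
    have T: "tangent_edges y \<subseteq> tangent_edges k"
      using V by (rule UN_mono) simp
    show "verts (extended_cone G S y) \<subseteq> verts (extended_cone G S k)"
      unfolding extended_cone_simps(1)[OF y] extended_cone_simps(1)[OF that(1)]
      using V UN_mono[OF T subset_refl, of fst] by (rule Un_mono)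
    show "edges (extended_cone G S y) \<subseteq> edges (extended_cone G S k)"
      unfolding extended_cone_simps(2)[OF y] extended_cone_simps(2)[OF that(1)]
      using E T by (rule Un_mono)
  qed
  have V: "\<phi> ` {y. (x, y) \<in> up\<^sup>*} = {y. (\<phi> x, y) \<in> up\<^sup>*}"
    using im(1) im'(1)
  proof (rule image_eq_if_right_inverse)
    fix y assume "y \<in> {y. (\<phi> x, y) \<in> up\<^sup>*}"
    then show "\<phi> (\<phi>' y) = y"
      using inv(3) sub(1)[OF assms(3) fx] cone_subset_extended_cone[OF x(2)] by blast
  qed
  have E: "\<psi> ` edges (cone G S x) = edges (cone G S (\<phi> x))"
    using im(2) im'(2)
  proof (rule image_eq_if_right_inverse)
    fix e assume "e \<in> edges (cone G S (\<phi> x))"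
    then show "\<psi> (\<psi>' e) = e"
      using inv(5) sub(2)[OF assms(3) fx] unfolding extended_cone_simps(2)[OF x(2)] by blast
  qed
  have T: "\<psi> ` tangent_edges x = tangent_edges (\<phi> x)"
    using im(3) im'(3)
  proof (rule image_eq_if_right_inverse)
    fix e assume "e \<in> tangent_edges (\<phi> x)"
    then show "\<psi> (\<psi>' e) = e"
      using inv(5) sub(2)[OF assms(3) fx] unfolding extended_cone_simps(2)[OF x(2)] by blast
  qed
  have inj: "inj_on \<phi> (verts (extended_cone G S x))" "inj_on \<psi> (edges (extended_cone G S x))"
    using assms(1) sub[OF assms(2,4)]
    by (auto simp: cone_iso_def graph_iso_def bij_betw_def intro: inj_on_subset)
  have ends: "fst (\<psi> e) = \<phi> ` fst e" if "e \<in> edges (extended_cone G S x)" for e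
    using cone_iso_ends(3)[OF assms(1-3)] sub[OF assms(2,4)] that by blast
  \<comment> \<open>Vertices outside the cone are reached only as ends of tangent edges, so their
    images are read off from the images of these edges.\<close>
  have "(\<Union>e\<in>tangent_edges (\<phi> x). fst e) = \<phi> ` (\<Union>e\<in>tangent_edges x. fst e)"
    unfolding T[symmetric] image_UN[of \<phi> fst] image_image
  proof (rule SUP_cong)
    fix e assume "e \<in> tangent_edges x"
    then show "fst (\<psi> e) = \<phi> ` fst e" using x by (intro ends) (simp add: extended_cone_simps(2))
  qed simp
  then have "\<phi> ` verts (extended_cone G S x) = verts (extended_cone G S (\<phi> x))"
    unfolding extended_cone_simps(1)[OF x(1)] extended_cone_simps(1)[OF x(2)] image_Un V
    by (rule arg_cong[where f = "(\<union>) _", OF sym])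
  moreover have "\<psi> ` edges (extended_cone G S x) = edges (extended_cone G S (\<phi> x))"
    unfolding extended_cone_simps(2)[OF x(1)] extended_cone_simps(2)[OF x(2)] image_Un E T ..
  ultimately have "graph_iso (extended_cone G S x) (extended_cone G S (\<phi> x)) \<phi> \<psi>"
    using inj ends x by (simp add: graph_iso_def bij_betw_def extended_cone_simps(3))
  then show ?thesis using V E x by (simp add: cone_iso_def verts_cone)
qed


section \<open>Vertex degrees and the invariance of \<open>m\<close>\<close>

definition incident :: "'a \<Rightarrow> ('a set \<times> 'a) set" where
  "incident g = {e \<in> edges \<Gamma>. g \<in> fst e}"

lemma finite_incident:
  assumes "g \<in> carrier G"
  shows "finite (incident g)"
proof (rule finite_subset)
  \<comment> \<open>In an edge labelled \<open>s\<close>, the vertex \<open>g\<close> is either the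
    base point or the base point multiplied by \<open>s\<close>.\<close>
  show "incident g \<subseteq> (\<Union>s\<in>S. {({g, s \<otimes> g}, s), ({inv s \<otimes> g, g}, s)})"
  proof
    fix e assume "e \<in> incident g"
    then obtain a s where as: "e = ({a, s \<otimes> a}, s)" "a \<in> carrier G" "s \<in> S" "g = a \<or> g = s \<otimes> a"
      by (auto simp: incident_def cayley_graph_def)
    then have "s \<in> carrier G" using gens_closed by blast
    then have "inv s \<otimes> (s \<otimes> a) = a" using as(2) by (simp flip: m_assoc)
    then have "e \<in> {({g, s \<otimes> g}, s), ({inv s \<otimes> g, g}, s)}" using as(1,4) by auto
    then show "e \<in> (\<Union>s\<in>S. {({g, s \<otimes> g}, s), ({inv s \<otimes> g, g}, s)})" using as(3) by blast
  qed
qed (use finite_gens in simp)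

text \<open>Right multiplication by \<open>inv a \<otimes> b\<close> commutes with the left
  multiplications that define edges, so it is a label-preserving automorphism carrying
  \<open>a\<close> to \<open>b\<close>. Exchanging \<open>a\<close> and \<open>b\<close> shows that
  all degrees agree.\<close>

lemma card_incident_le:
  assumes a: "a \<in> carrier G" and b: "b \<in> carrier G"
  shows "card (incident a) \<le> card (incident b)"
proof (rule card_inj_on_le)
  define c where "c = inv a \<otimes> b"
  have c: "c \<in> carrier G" "a \<otimes> c = b"
    using a b by (simp_all add: c_def flip: m_assoc)
  let ?f = "\<lambda>(E, s). ((\<lambda>x. x \<otimes> c) ` E, s)"
  have "inj_on (\<lambda>x. x \<otimes> c) (carrier G)" using c by (intro inj_onI) simp
  then have cancel: "E = E'"
    if "(\<lambda>x. x \<otimes> c) ` E = (\<lambda>x. x \<otimes> c) ` E'" "E \<subseteq> carrier G" "E' \<subseteq> carrier G" for E E'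
    using that inj_on_image_eq_iff by metis
  show "inj_on ?f (incident a)"
  proof (rule inj_onI)
    fix d e assume "d \<in> incident a" "e \<in> incident a" and eq: "?f d = ?f e"
    then have sub: "fst d \<subseteq> carrier G" "fst e \<subseteq> carrier G"
      using edge_ends_closed by (simp_all add: incident_def)
    have "(\<lambda>x. x \<otimes> c) ` fst d = (\<lambda>x. x \<otimes> c) ` fst e" "snd d = snd e"
      using eq by (simp_all add: case_prod_beta)
    then show "d = e" using cancel[OF _ sub] prod_eqI by blast
  qed
  show "?f ` incident a \<subseteq> incident b"
  proof
    fix d assume "d \<in> ?f ` incident a"
    then obtain x s where x: "x \<in> carrier G" "s \<in> S" "a \<in> {x, s \<otimes> x}"
      and d: "d = ({x \<otimes> c, s \<otimes> x \<otimes> c}, s)"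
      by (auto simp: incident_def cayley_graph_def)
    have "s \<in> carrier G" using x gens_closed by blast
    then have "d = ({x \<otimes> c, s \<otimes> (x \<otimes> c)}, s)" using d x c by (simp add: m_assoc)
    then have "d \<in> edges \<Gamma>" using x c by (auto simp: cayley_graph_def)
    moreover have "b \<in> fst d" using x(3) d c(2) by auto
    ultimately show "d \<in> incident b" by (simp add: incident_def)
  qed
  show "finite (incident b)" by (rule finite_incident[OF b])
qed

lemma down_edges_at_iff:
  "e \<in> down_edges_at G S g \<longleftrightarrow> e \<in> edges \<Gamma> \<and> (\<exists>h. fst e = {g, h} \<and> Suc (len h) = len g)"
  by (simp add: down_edges_at_def)

lemma up_edges_at_iff:
  "e \<in> up_edges_at G S g \<longleftrightarrow> e \<in> edges \<Gamma> \<and> (\<exists>h. fst e = {g, h} \<and> len h = Suc (len g))"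
  by (simp add: up_edges_at_def)

lemma down_edges_at_subset: "down_edges_at G S g \<subseteq> incident g"
  by (auto simp: down_edges_at_iff incident_def)

lemma finite_down_edges_at: "g \<in> carrier G \<Longrightarrow> finite (down_edges_at G S g)"
  using down_edges_at_subset finite_incident by (rule finite_subset)

lemma finite_up_edges_at: "g \<in> carrier G \<Longrightarrow> finite (up_edges_at G S g)"
  using finite_incident by (rule finite_subset[rotated]) (auto simp: up_edges_at_iff incident_def)

text \<open>The two ends of such an edge differ in length, so the length singles out the upper one.
  Thus edges counted at different vertices of a sphere are different.\<close>

lemma down_edges_at_unique:
  assumes "e \<in> down_edges_at G S h" "e \<in> down_edges_at G S h'" "len h = len h'"
  shows "h = h'"
proof -
  obtain g g' where "fst e = {h, g}" "Suc (len g) = len h" "fst e = {h', g'}" "Suc (len g') = len h'"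
    using assms(1,2) unfolding down_edges_at_iff by blast
  then show ?thesis using assms(3) by (metis doubleton_eq_iff n_not_Suc_n)
qed

lemma up_edges_at_unique:
  assumes "e \<in> up_edges_at G S g" "e \<in> up_edges_at G S g'" "len g = len g'"
  shows "g = g'"
proof -
  obtain h h' where "fst e = {g, h}" "len h = Suc (len g)" "fst e = {g', h'}" "len h' = Suc (len g')"
    using assms(1,2) unfolding up_edges_at_iff by blast
  then show ?thesis using assms(3) by (metis doubleton_eq_iff n_not_Suc_n)
qed

text \<open>Upward edges at \<open>g\<close> lie in the cone and tangent ones are added to it. A
  downward edge is excluded: no vertex of the cone is shorter than \<open>g\<close>, and the other
  edges of the extended cone are tangent.\<close>

lemma incident_extended_cone:
  assumes "g \<in> carrier G"
  shows "{e \<in> edges (extended_cone G S g). g \<in> fst e} = incident g - down_edges_at G S g"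
proof (intro equalityI subsetI)
  fix e assume "e \<in> {e \<in> edges (extended_cone G S g). g \<in> fst e}"
  then have e: "e \<in> edges (extended_cone G S g)" "g \<in> fst e" by auto
  have "len g \<le> len y" if "fst e = {g, y}" for y
  proof (cases "e \<in> edges (cone G S g)")
    case True
    then show ?thesis using assms that by (auto simp: edges_cone dest: up_rtrancl_len_le)
  next
    case False
    then obtain k k' where "fst e = {k, k'}" "len k' = len k"
      using e assms by (auto simp: extended_cone_simps tangent_edges_at_iff)
    then show ?thesis using that by (auto simp: doubleton_eq_iff)
  qed
  then show "e \<in> incident g - down_edges_at G S g"
    using e edges_extended_cone_subset[OF assms] by (fastforce simp: incident_def down_edges_at_iff)
next
  fix e assume "e \<in> incident g - down_edges_at G S g"
  then have e: "e \<in> edges \<Gamma>" "g \<in> fst e" "e \<notin> down_edges_at G S g"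
    by (auto simp: incident_def)
  then obtain y where y: "fst e = {g, y}" "adj g y" using edge_ends by blast
  have "len g \<le> Suc (len y)" "len y \<le> Suc (len g)" using adj_len_le y(2) adj_sym by blast+
  moreover have "Suc (len y) \<noteq> len g" using e(1,3) y(1) by (auto simp: down_edges_at_iff)
  ultimately consider "len y = len g" | "len y = Suc (len g)" by linarith
  then have "e \<in> edges (extended_cone G S g)"
  proof cases
    case 1
    then have "e \<in> tangent_edges_at G S g" using e(1) y(1) by (auto simp: tangent_edges_at_iff)
    then show ?thesis using assms by (auto simp: extended_cone_simps)
  next
    case 2
    then have "(g, y) \<in> up" using y(2) by (simp add: up_def)
    then show ?thesis using up_edge_in_cone[OF assms _ _ e(1) y(1)] by blast
  qed
  then show "e \<in> {e \<in> edges (extended_cone G S g). g \<in> fst e}" using e(2) by simp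
qed

text \<open>The second summand is preserved by isomorphisms fixing base points and the right side
  does not depend on \<open>g\<close>, so \<open>cone_m\<close> is an invariant of strong
  equivalence although downward edges lie outside the extended cone.\<close>

lemma cone_m_eq:
  assumes "g \<in> carrier G"
  shows "cone_m G S g + card {e \<in> edges (extended_cone G S g). g \<in> fst e} = card (incident \<one>)"
proof -
  have "card (down_edges_at G S g) + card (incident g - down_edges_at G S g) = card (incident g)"
    using finite_incident[OF assms] down_edges_at_subset[of g]
    by (metis add.commute card_Diff_subset card_mono finite_subset le_add_diff_inverse2)
  moreover have "card (incident g) = card (incident \<one>)"
    using assms by (intro antisym card_incident_le) auto
  ultimately show ?thesis by (simp add: incident_extended_cone[OF assms] cone_m_def)
qed

lemma cone_iso_card_incident_le:
  assumes "cone_iso G S g h \<phi> \<psi>" "g \<in> carrier G" "h \<in> carrier G"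
  shows "card {e \<in> edges (extended_cone G S g). g \<in> fst e} \<le> card {e \<in> edges (extended_cone G S h). h \<in> fst e}"
proof (rule card_inj_on_le)
  show "inj_on \<psi> {e \<in> edges (extended_cone G S g). g \<in> fst e}"
    using assms(1) by (auto simp: cone_iso_def graph_iso_def bij_betw_def intro: inj_on_subset)
  have "\<phi> g = h" using assms(1) by (simp add: cone_iso_def)
  then show "\<psi> ` {e \<in> edges (extended_cone G S g). g \<in> fst e} \<subseteq> {e \<in> edges (extended_cone G S h). h \<in> fst e}"
    using cone_iso_ends[OF assms] by blast
  show "finite {e \<in> edges (extended_cone G S h). h \<in> fst e}"
    using incident_extended_cone[OF assms(3)] finite_incident[OF assms(3)] by simp
qed

lemma strongly_equivalent_cone_m:
  assumes "strongly_equivalent G S g h" "g \<in> carrier G" "h \<in> carrier G"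
  shows "cone_m G S g = cone_m G S h"
proof -
  have "card {e \<in> edges (extended_cone G S g). g \<in> fst e} = card {e \<in> edges (extended_cone G S h). h \<in> fst e}"
    using assms strongly_equivalent_sym[OF assms(1,2)] cone_iso_card_incident_le
    unfolding strongly_equivalent_iff by (meson antisym)
  then show ?thesis using cone_m_eq[OF assms(2)] cone_m_eq[OF assms(3)] by simp
qed

lemma cone_m_one: "cone_m G S \<one> = 0"
proof -
  have "down_edges_at G S \<one> = {}" by (auto simp: down_edges_at_iff)
  then show ?thesis by (simp add: cone_m_def)
qed

lemma cone_m_pos:
  assumes "g \<in> carrier G" "g \<noteq> \<one>"
  shows "cone_m G S g > 0"
proof -
  obtain h where "(h, g) \<in> up" using ex_up_step[OF assms] ..
  then have "adj g h" "len g = Suc (len h)" by (auto simp: up_def intro: adj_sym)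
  then have "down_edges_at G S g \<noteq> {}" by (fastforce simp: adj_def down_edges_at_iff)
  then show ?thesis
    using finite_down_edges_at[OF assms(1)]
    by (simp add: cone_m_def card_gt_0_iff)
qed

lemma strongly_equivalent_one:
  assumes "strongly_equivalent G S g \<one>" "g \<in> carrier G"
  shows "g = \<one>"
  using strongly_equivalent_cone_m[OF assms] cone_m_one cone_m_pos[OF assms(2)] by force

text \<open>The edge map injects the counted edges at \<open>g\<close> into those at
  \<open>g'\<close>: up steps go to up steps, and restricting the isomorphism at the upper end
  \<open>x\<close> shows that \<open>x\<close> and \<open>\<phi> x\<close> have the same type.
  Symmetry then gives equality.\<close>

lemma cone_n_le:
  assumes "strongly_equivalent G S g g'" "strongly_equivalent G S h h'"
    and g: "g \<in> carrier G" "g' \<in> carrier G"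
  shows "cone_n G S g h \<le> cone_n G S g' h'"
proof -
  obtain \<phi> \<psi> where iso: "cone_iso G S g g' \<phi> \<psi>" using assms(1) by (auto simp: strongly_equivalent_iff)
  define A where "A = (\<lambda>g h. {e \<in> up_edges_at G S g. \<exists>x. fst e = {g, x} \<and> strongly_equivalent G S x h})"
  have \<phi>: "\<phi> g = g'" "inj_on \<psi> (edges (extended_cone G S g))"
    using iso by (auto simp: cone_iso_def graph_iso_def bij_betw_def)
  have A: "e \<in> edges (extended_cone G S g) \<and> \<psi> e \<in> A g' h'" if "e \<in> A g h" for e
  proof -
    from that obtain x y where xy: "e \<in> edges \<Gamma>" "fst e = {g, x}" "fst e = {g, y}" "len x = Suc (len g)"
      "strongly_equivalent G S y h"
      by (auto simp: A_def up_edges_at_iff)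
    \<comment> \<open>The upper end is quantified separately in \<open>up_edges_at\<close> and in
      \<open>cone_n\<close>; one end being \<open>g\<close>, the other is determined.\<close>
    then have "x = y" by (auto simp: doubleton_eq_iff)
    have up: "(g, x) \<in> up" using xy by (auto simp: up_def adj_def)
    have ext: "e \<in> edges (extended_cone G S g)" using up_edge_in_cone[OF g(1) _ up xy(1,2)] by blast
    have x: "x \<in> carrier G" using up_closed[OF up] by blast
    have "cone_iso G S x (\<phi> x) \<phi> \<psi>" using cone_iso_restrict[OF iso g] up by blast
    then have "strongly_equivalent G S x (\<phi> x)" by (auto simp: strongly_equivalent_iff)
    then have "strongly_equivalent G S (\<phi> x) h'"
      using xy(5) assms(2) \<open>x = y\<close> x by (blast intro: strongly_equivalent_sym strongly_equivalent_trans)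
    moreover have "(g', \<phi> x) \<in> up" using cone_iso_up[OF iso g _ up] \<phi>(1) by simp
    then have "len (\<phi> x) = Suc (len g')" by (simp add: up_def)
    moreover have "\<psi> e \<in> edges \<Gamma>" "fst (\<psi> e) = {g', \<phi> x}"
      using cone_iso_ends[OF iso g ext] \<phi>(1) xy(2) by auto
    ultimately show ?thesis using ext by (auto simp: A_def up_edges_at_iff)
  qed
  have "card (A g h) \<le> card (A g' h')"
  proof (rule card_inj_on_le)
    show "inj_on \<psi> (A g h)" using \<phi>(2) A by (meson inj_on_subset subsetI)
    show "\<psi> ` A g h \<subseteq> A g' h'" using A by blast
    show "finite (A g' h')" using finite_up_edges_at[OF g(2)] by (simp add: A_def)
  qed
  then show ?thesis by (simp add: cone_n_def A_def)
qed

lemma strongly_equivalent_cone_n: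
  assumes "strongly_equivalent G S g g'" "strongly_equivalent G S h h'"
    and "g \<in> carrier G" "g' \<in> carrier G" "h \<in> carrier G" "h' \<in> carrier G"
  shows "cone_n G S g h = cone_n G S g' h'"
  using cone_n_le[OF assms(1-4)] cone_n_le[OF strongly_equivalent_sym[OF assms(1,3)]
      strongly_equivalent_sym[OF assms(2,5)] assms(4,3)] by simp

section \<open>Double counting of edges between consecutive spheres\<close>

lemma finite_sphere: "finite {g \<in> carrier G. len g = k}"
proof (induction k)
  case 0
  have "{g \<in> carrier G. len g = 0} \<subseteq> {\<one>}" using len_eq_0 by blast
  then show ?case by (rule finite_subset) simp
next
  case (Suc k)
  have "{g \<in> carrier G. len g = Suc k} \<subseteq>
      (\<Union>h\<in>{h \<in> carrier G. len h = k}. \<Union>s\<in>S. {s \<otimes> h, inv s \<otimes> h})"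
  proof
    fix g assume g: "g \<in> {g \<in> carrier G. len g = Suc k}"
    then have "g \<noteq> \<one>" by auto
    then obtain h where "(h, g) \<in> up" using ex_up_step g by blast
    then have "h \<in> carrier G" "len h = k" "adj h g" using g up_closed by (auto simp: up_def)
    then show "g \<in> (\<Union>h\<in>{h \<in> carrier G. len h = k}. \<Union>s\<in>S. {s \<otimes> h, inv s \<otimes> h})"
      by (auto simp: adj_iff)
  qed
  then show ?case by (rule finite_subset) (use Suc finite_gens in simp)
qed

text \<open>Both sides count the edges from the sphere of radius \<open>k\<close> up to elements of
  \<open>B\<close>, grouped by upper end on the left and by lower end on the right.\<close>

lemma sum_cone_m_sphere:
  assumes B: "B \<subseteq> carrier G"
  shows "(\<Sum>h\<in>{h \<in> B. len h = Suc k}. cone_m G S h) =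
    (\<Sum>g\<in>{g \<in> carrier G. len g = k}. card {e \<in> up_edges_at G S g. \<exists>h\<in>B. fst e = {g, h}})"
proof -
  let ?up = "\<lambda>g. {e \<in> up_edges_at G S g. \<exists>h\<in>B. fst e = {g, h}}"
  have "(\<Sum>h\<in>{h \<in> B. len h = Suc k}. cone_m G S h) =
      card (\<Union>h\<in>{h \<in> B. len h = Suc k}. down_edges_at G S h)"
    unfolding cone_m_def
  proof (rule card_UN_disjoint[symmetric])
    show "finite {h \<in> B. len h = Suc k}"
      using B by (intro finite_subset[OF _ finite_sphere[of "Suc k"]]) auto
    show "\<forall>h\<in>{h \<in> B. len h = Suc k}. finite (down_edges_at G S h)"
      using B by (auto intro!: finite_down_edges_at)
    show "\<forall>h\<in>{h \<in> B. len h = Suc k}. \<forall>h'\<in>{h \<in> B. len h = Suc k}. h \<noteq> h' \<longrightarrow>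
        down_edges_at G S h \<inter> down_edges_at G S h' = {}"
      using down_edges_at_unique by fastforce
  qed
  also have "(\<Union>h\<in>{h \<in> B. len h = Suc k}. down_edges_at G S h) =
      (\<Union>g\<in>{g \<in> carrier G. len g = k}. ?up g)"
  proof (intro equalityI subsetI)
    fix e assume "e \<in> (\<Union>h\<in>{h \<in> B. len h = Suc k}. down_edges_at G S h)"
    then obtain h g where "h \<in> B" "len h = Suc k" "e \<in> edges \<Gamma>" "fst e = {g, h}" "len g = k"
      by (auto simp: down_edges_at_iff insert_commute)
    moreover have "g \<in> carrier G" using calculation edge_ends_closed by blast
    ultimately show "e \<in> (\<Union>g\<in>{g \<in> carrier G. len g = k}. ?up g)"
      by (auto simp: up_edges_at_iff)
  next
    fix e assume "e \<in> (\<Union>g\<in>{g \<in> carrier G. len g = k}. ?up g)"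
    then obtain g h where e: "len g = k" "e \<in> up_edges_at G S g" "h \<in> B" "fst e = {g, h}"
      by blast
    then obtain h' where h': "e \<in> edges \<Gamma>" "fst e = {g, h'}" "len h' = Suc (len g)"
      unfolding up_edges_at_iff by blast
    have "h = h'" using e(4) h'(2,3) by (auto simp: doubleton_eq_iff)
    then have "e \<in> down_edges_at G S h" using e h' by (auto simp: down_edges_at_iff insert_commute)
    then show "e \<in> (\<Union>h\<in>{h \<in> B. len h = Suc k}. down_edges_at G S h)"
      using e h' \<open>h = h'\<close> by blast
  qed
  also have "card \<dots> = (\<Sum>g\<in>{g \<in> carrier G. len g = k}. card (?up g))"
  proof (rule card_UN_disjoint)
    show "finite {g \<in> carrier G. len g = k}" by (rule finite_sphere)
    show "\<forall>g\<in>{g \<in> carrier G. len g = k}. finite (?up g)"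
      using finite_up_edges_at by simp
    show "\<forall>g\<in>{g \<in> carrier G. len g = k}. \<forall>g'\<in>{g \<in> carrier G. len g = k}. g \<noteq> g' \<longrightarrow> ?up g \<inter> ?up g' = {}"
      using up_edges_at_unique by fastforce
  qed
  finally show ?thesis .
qed

section \<open>Extended cone types and their numbers \<open>m\<close> and \<open>n\<close>\<close>

lemma extended_cone_typeD:
  assumes "T \<in> extended_cone_types G S"
  shows "T \<subseteq> carrier G" "T \<noteq> {}"
    "h \<in> T \<Longrightarrow> h' \<in> T \<longleftrightarrow> h' \<in> carrier G \<and> strongly_equivalent G S h' h"
proof -
  let ?R = "{(g, h). g \<in> carrier G \<and> h \<in> carrier G \<and> strongly_equivalent G S g h}"
  have T: "T \<in> carrier G // ?R" using assms by (simp add: extended_cone_types_def)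
  show sub: "T \<subseteq> carrier G" using in_quotient_imp_subset[OF equiv_strongly_equivalent T] .
  show "T \<noteq> {}" using in_quotient_imp_non_empty[OF equiv_strongly_equivalent T] .
  show "h' \<in> T \<longleftrightarrow> h' \<in> carrier G \<and> strongly_equivalent G S h' h" if h: "h \<in> T"
  proof
    assume "h' \<in> T"
    then have "(h', h) \<in> ?R" using in_quotient_imp_in_rel[OF equiv_strongly_equivalent T] h by simp
    then show "h' \<in> carrier G \<and> strongly_equivalent G S h' h" by simp
  next
    assume "h' \<in> carrier G \<and> strongly_equivalent G S h' h"
    then have "(h, h') \<in> ?R" using strongly_equivalent_sym h sub by blast
    then show "h' \<in> T" by (rule in_quotient_imp_closed[OF equiv_strongly_equivalent T h])
  qed
qed

text \<open>Invariance of \<open>cone_m\<close> on \<open>T\<close> and the presence of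
  \<open>g\<close> in \<open>T\<close> make the definite description in \<open>type_m\<close> well
  defined.\<close>

lemma type_m_eq:
  assumes "T \<in> extended_cone_types G S" "g \<in> T"
  shows "type_m G S T = cone_m G S g"
  unfolding type_m_def
proof (rule the_equality)
  show "\<forall>g'\<in>T. cone_m G S g' = cone_m G S g"
    using extended_cone_typeD[OF assms(1)] assms(2) strongly_equivalent_cone_m by blast
qed (use assms(2) in auto)

lemma type_n_eq:
  assumes "T \<in> extended_cone_types G S" "g \<in> T" "U \<in> extended_cone_types G S" "h \<in> U"
  shows "type_n G S T U = cone_n G S g h"
  unfolding type_n_def
proof (rule the_equality)
  show "\<forall>g'\<in>T. \<forall>h'\<in>U. cone_n G S g' h' = cone_n G S g h"
  proof (intro ballI)
    fix g' h' assume "g' \<in> T" "h' \<in> U"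
    then have "strongly_equivalent G S g' g" "strongly_equivalent G S h' h"
      "g' \<in> carrier G" "h' \<in> carrier G" "g \<in> carrier G" "h \<in> carrier G"
      using extended_cone_typeD[OF assms(1)] extended_cone_typeD[OF assms(3)] assms(2,4) by blast+
    then show "cone_n G S g' h' = cone_n G S g h" by (intro strongly_equivalent_cone_n)
  qed
qed (use assms(2,4) in auto)

section \<open>Growth series of the individual types\<close>

context
  fixes q and t :: "nat \<Rightarrow> 'a set"
  assumes types: "bij_betw t {..q} (extended_cone_types G S)"
begin

lemma type_mem: "j \<le> q \<Longrightarrow> t j \<in> extended_cone_types G S"
  using types by (auto simp: bij_betw_def)

lemma types_disjoint:
  assumes "i \<le> q" "j \<le> q" "i \<noteq> j"
  shows "t i \<inter> t j = {}"
proof -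
  have "t i \<noteq> t j" using types assms by (auto simp: bij_betw_def inj_on_def)
  then show ?thesis
    using quotient_disj[OF equiv_strongly_equivalent] type_mem assms(1,2)
    unfolding extended_cone_types_def by blast
qed

lemma sphere_eq: "{g \<in> carrier G. len g = k} = (\<Union>i\<le>q. {g \<in> t i. len g = k})"
proof -
  have "(\<Union>i\<le>q. t i) = carrier G"
    using Union_quotient[OF equiv_strongly_equivalent] types
    by (simp add: bij_betw_def extended_cone_types_def)
  then show ?thesis by blast
qed

lemma finite_type_sphere: "i \<le> q \<Longrightarrow> finite {g \<in> t i. len g = k}"
  using finite_sphere[of k] unfolding sphere_eq by (rule finite_subset[rotated]) auto

lemma sum_sphere:
  fixes c :: "'a \<Rightarrow> nat"
  shows "(\<Sum>g\<in>{g \<in> carrier G. len g = k}. c g) = (\<Sum>i\<le>q. \<Sum>g\<in>{g \<in> t i. len g = k}. c g)"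
  unfolding sphere_eq
proof (rule sum.UNION_disjoint)
  show "\<forall>i\<in>{..q}. \<forall>j\<in>{..q}. i \<noteq> j \<longrightarrow> {g \<in> t i. len g = k} \<inter> {g \<in> t j. len g = k} = {}"
    using types_disjoint by blast
qed (simp_all add: finite_type_sphere)

text \<open>This is the double count with \<open>B = t j\<close>, where \<open>m\<close> is constant
  on \<open>t j\<close> and \<open>n\<close> on each \<open>t i\<close>. It is the coefficient of
  degree \<open>Suc k\<close> in row \<open>j\<close> of the system, cleared of the
  denominator.\<close>

lemma type_recurrence:
  assumes j: "j \<le> q"
  shows "type_m G S (t j) * card {h \<in> t j. len h = Suc k} =
    (\<Sum>i\<le>q. type_n G S (t i) (t j) * card {g \<in> t i. len g = k})"
proof -
  note tj = extended_cone_typeD[OF type_mem[OF j]]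
  obtain h where h: "h \<in> t j" using tj(2) by blast
  have edges: "card {e \<in> up_edges_at G S g. \<exists>h\<in>t j. fst e = {g, h}} = type_n G S (t i) (t j)"
    if g: "i \<le> q" "g \<in> t i" for i g
  proof -
    have "{e \<in> up_edges_at G S g. \<exists>h\<in>t j. fst e = {g, h}} =
        {e \<in> up_edges_at G S g. \<exists>x. fst e = {g, x} \<and> strongly_equivalent G S x h}"
      using tj(3)[OF h] edge_ends_closed by (fastforce simp: up_edges_at_iff)
    then show ?thesis by (simp add: type_n_eq[OF type_mem[OF g(1)] g(2) type_mem[OF j] h] cone_n_def)
  qed
  have "type_m G S (t j) * card {h \<in> t j. len h = Suc k} = (\<Sum>h\<in>{h \<in> t j. len h = Suc k}. cone_m G S h)"
    by (simp add: type_m_eq[OF type_mem[OF j], symmetric])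
  also have "\<dots> = (\<Sum>i\<le>q. \<Sum>g\<in>{g \<in> t i. len g = k}. card {e \<in> up_edges_at G S g. \<exists>h\<in>t j. fst e = {g, h}})"
    by (simp add: sum_cone_m_sphere[OF tj(1)] sum_sphere)
  also have "\<dots> = (\<Sum>i\<le>q. \<Sum>g\<in>{g \<in> t i. len g = k}. type_n G S (t i) (t j))"
    by (intro sum.cong refl) (simp add: edges)
  finally show ?thesis by (simp add: mult.commute)
qed

lemma type_zero:
  assumes "\<one> \<in> t 0"
  shows "t 0 = {\<one>}"
  using extended_cone_typeD[OF type_mem[of 0]] assms strongly_equivalent_one by auto

lemma type_m_pos:
  assumes "\<one> \<in> t 0" "j \<in> {1..q}"
  shows "type_m G S (t j) > 0"
proof -
  obtain g where g: "g \<in> t j" "g \<in> carrier G"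
    using extended_cone_typeD[OF type_mem[of j]] assms(2) by auto
  moreover have "g \<noteq> \<one>" using types_disjoint[of 0 j] assms g(1) by auto
  ultimately show ?thesis
    using cone_m_pos type_m_eq[OF type_mem[of j] g(1)] assms(2) by simp
qed

text \<open>These are the power series solutions \<open>f j\<close> of the linear system.\<close>

definition type_series :: "nat \<Rightarrow> rat fps" where
  "type_series j = Abs_fps (\<lambda>k. of_nat (card {g \<in> t j. len g = k}))"

lemma spherical_growth_eq_sum: "spherical_growth G S = (\<Sum>j\<le>q. type_series j)"
proof (rule fps_ext)
  fix k
  have "card {g \<in> carrier G. len g = k} = (\<Sum>j\<le>q. card {g \<in> t j. len g = k})"
    using sum_sphere[of "\<lambda>_. 1" k] by simp
  then show "fps_nth (spherical_growth G S) k = fps_nth (\<Sum>j\<le>q. type_series j) k"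
    by (simp add: spherical_growth_def type_series_def fps_sum_nth)
qed

lemma growth_system_type_series:
  assumes one: "\<one> \<in> t 0"
    and m: "\<And>j. j \<le> q \<Longrightarrow> m j = type_m G S (t j)"
    and n: "\<And>i j. i \<le> q \<Longrightarrow> j \<le> q \<Longrightarrow> n i j = type_n G S (t i) (t j)"
  shows "growth_system fps_X q m n type_series"
proof -
  \<comment> \<open>The identity is alone in its type, which gives the equation
    \<open>f 0 = 1\<close>.\<close>
  have "{g \<in> t 0. len g = k} = (if k = 0 then {\<one>} else {})" for k
    by (auto simp: type_zero[OF one])
  then have zero: "type_series 0 = 1"
    by (intro fps_ext) (simp add: type_series_def)
  have "type_series j = fps_X / of_nat (m j) * (\<Sum>i\<le>q. of_nat (n i j) * type_series i)"
    if j: "j \<in> {1..q}" for j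
  proof -
    let ?F = "\<Sum>i\<le>q. of_nat (n i j) * type_series i"
    have "m j \<noteq> 0" using type_m_pos[OF one j] m j by simp
    then have unit: "fps_nth (of_nat (m j) :: rat fps) 0 \<noteq> 0" by simp
    have of_nat_nth: "fps_nth (of_nat c * F) k = of_nat c * fps_nth F k" for c k and F :: "rat fps"
      by (simp flip: fps_of_nat)
    \<comment> \<open>Coefficients are compared before dividing by \<open>m j\<close>. The factor
      \<open>fps_X\<close> shifts the index, so degree \<open>Suc l\<close> is the recurrence at
      \<open>l\<close>.\<close>
    have "of_nat (m j) * type_series j = fps_X * ?F"
    proof (rule fps_ext)
      fix k
      show "fps_nth (of_nat (m j) * type_series j) k = fps_nth (fps_X * ?F) k"
      proof (cases k)
        case 0
        \<comment> \<open>The right side has constant coefficient zero. So does the left one, since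
          the only element of length zero belongs to type \<open>0\<close>.\<close>
        have "\<one> \<notin> t j" using types_disjoint[of 0 j] j one by auto
        then have "{g \<in> t j. len g = 0} = {}"
          using len_eq_0 extended_cone_typeD(1)[OF type_mem[of j]] j by auto
        then have "card {g \<in> t j. len g = 0} = 0" by (simp only: card.empty)
        then show ?thesis using 0 by (simp add: of_nat_nth type_series_def)
      next
        case (Suc l)
        have "m j * card {h \<in> t j. len h = Suc l} = (\<Sum>i\<le>q. n i j * card {g \<in> t i. len g = l})"
          using type_recurrence[of j l] m n j by simp
        then have "(of_nat (m j * card {h \<in> t j. len h = Suc l}) :: rat) =
            of_nat (\<Sum>i\<le>q. n i j * card {g \<in> t i. len g = l})" by simp
        then show ?thesis using Suc by (simp add: of_nat_nth type_series_def fps_sum_nth)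
      qed
    qed
    then have "fps_X / of_nat (m j) * ?F = inverse (of_nat (m j)) * of_nat (m j) * type_series j"
      by (simp add: fps_divide_unit[OF unit] ac_simps)
    then show ?thesis by (simp add: inverse_mult_eq_1[OF unit])
  qed
  then show ?thesis using zero by (simp add: growth_system_def)
qed

end

end

section \<open>Rationality of the spherical growth series\<close>

theorem theorem3p6:
  fixes G :: "('a, 'b) monoid_scheme" and S :: "'a set" and q :: nat
    and t :: "nat \<Rightarrow> 'a set" and m :: "nat \<Rightarrow> nat" and n :: "nat \<Rightarrow> nat \<Rightarrow> nat"
  assumes "group G"
    and "finite S" and "S \<subseteq> carrier G" and "generate G S = carrier G"
    and types: "bij_betw t {..q} (extended_cone_types G S)" and "\<one>\<^bsub>G\<^esub> \<in> t 0"
    and m: "\<And>j. j \<le> q \<Longrightarrow> m j = type_m G S (t j)"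
    and n: "\<And>i j. i \<le> q \<Longrightarrow> j \<le> q \<Longrightarrow> n i j = type_n G S (t i) (t j)"
  shows
    \<comment> \<open>rationality\<close>
    "(\<exists>P Q :: rat poly. Q \<noteq> 0 \<and> spherical_growth G S * fps_of_poly Q = fps_of_poly P) \<and>
    \<comment> \<open>a presentation computed from the data\<close>
     (growth_denominator q m n \<noteq> 0 \<and>
      spherical_growth G S * fps_of_poly (growth_denominator q m n) =
        fps_of_poly (growth_numerator q m n)) \<and>
    \<comment> \<open>the linear system, solved in rational functions\<close>
     (\<exists>!f. f \<in> extensional {..q} \<and> growth_system ratfun_z q m n f) \<and>
     (\<forall>f. growth_system ratfun_z q m n f \<longrightarrow> expands_to (\<Sum>j\<le>q. f j) (spherical_growth G S)) \<and>
    \<comment> \<open>the linear system, solved in power series\<close>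
     (\<exists>!f :: nat \<Rightarrow> rat fps. f \<in> extensional {..q} \<and> growth_system fps_X q m n f) \<and>
     (\<forall>f :: nat \<Rightarrow> rat fps. growth_system fps_X q m n f \<longrightarrow> spherical_growth G S = (\<Sum>j\<le>q. f j))"
proof -
  interpret finitely_generated_group G S
    using assms(1-4) by (intro finitely_generated_group.intro finitely_generated_group_axioms.intro)
  have m_ne: "m j \<noteq> 0" if "j \<in> {1..q}" for j
    using type_m_pos[OF types assms(6) that] m[of j] that by simp
  have system: "growth_system fps_X q m n (type_series t)"
    using types assms(6) m n by (rule growth_system_type_series)
  \<comment> \<open>The growth series of the types provide the one power series solution that the
    algebraic half asks for.\<close>
  note solutions = growth_system_solutions[of q m n, OF m_ne system spherical_growth_eq_sum[OF types]]
  show ?thesis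
    using solutions by (intro conjI exI[of _ "growth_numerator q m n"] exI[of _ "growth_denominator q m n"] allI impI)
qed

end
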